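(* Let $\mathcal{E}$ be a cocomplete closed symmetric monoidal $\mathcal{V}$-category with associated adjunction $i\colon\mathcal{V}\leftrightarrows\mathcal{E}\colon r$ and unit $I$. (a) Let $(L,l)$ be an $(i,r)$-localization functor in $\mathcal{E}$. If $LI\cong i(B)$ for some $B$ in $\mathcal{V}$, then $LI$ (with the monoid structure for which $l_I\colon I\to LI$ is a morphism of monoids) is an $(i,r)$-rigid monoid in $\mathcal{E}$. (b) All $(i,r)$-rigid monoids appear in this way as localizations of the unit: for every $(i,r)$-rigid monoid $R$ in $\mathcal{E}$ there is an $(i,r)$-localization functor $L$ in $\mathcal{E}$ such that $R\cong LI$.
   Context: Let $\mathcal{V}$ be a symmetric monoidal category. A closed symmetric monoidal $\mathcal{V}$-category is a closed symmetric monoidal category $\mathcal{E}$ (tensor $\otimes$, unit $I$, internal hom $\operatorname{Hom}_{\mathcal{E}}$) with an adjunction $i\colon\mathcal{V}\leftrightarrows\mathcal{E}\colon r$ whose left adjoint $i$ is strong (symmetric) monoidal. Write $\operatorname{Hom}(X,Y)=r(\operatorname{Hom}_{\mathcal{E}}(X,Y))\in\mathcal{V}$. A localization functor in $\mathcal{E}$ is a functor $L$ with a natural transformation $l\colon \mathrm{Id}\to L$ such that $l_{LX}=Ll_X$ is an isomorphism for every $X$. The $L$-local objects are the objects isomorphic to one in the image of $L$; $f$ is an $L$-local equivalence if $L(f)$ is an isomorphism. It is an $(i,r)$-localization functor if for every $L$-local equivalence $f\colon X\to Y$ and every $L$-local object $Z$, the map $f^*\colon\operatorname{Hom}(Y,Z)\to\operatorname{Hom}(X,Z)$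 is an isomorphism in $\mathcal{V}$. A monoid $(R,\mu,\eta)$ in $\mathcal{E}$ is $(i,r)$-rigid if $\eta^*\colon\operatorname{Hom}(R,R)\to\operatorname{Hom}(I,R)$ is an isomorphism in $\mathcal{V}$. For a class $\mathcal{L}$ of morphisms, $Z$ is $\mathcal{L}$-local if $f^*\colon\operatorname{Hom}(Y,Z)\to\operatorname{Hom}(X,Z)$ is an isomorphism for all $f\colon X\to Y$ in $\mathcal{L}$, and $g\colon U\to W$ is an $\mathcal{L}$-local equivalence if $g^*\colon\operatorname{Hom}(W,Z)\to\operatorname{Hom}(U,Z)$ is an isomorphism for all $\mathcal{L}$-local $Z$. An $(i,r)$-$\mathcal{L}$-localization functor is an $(i,r)$-localization functor whose local objects and local equivalences are the $\mathcal{L}$-local objects and the $\mathcal{L}$-local equivalences. Standing assumption: for every morphism $f$ of $\mathcal{E}$, the $(i,r)$-$\{f\}$-localization functor exists. When $LI\cong i(B)$ for an $(i,r)$-localization functor $(L,l)$, there is a unique monoid structure on $LI$ for which $l_I$ is a morphism of monoids from $I$ with its canonical monoid structure. *)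

theory Defs
  imports Main
begin

section \<open>Categories, functors, natural transformations\<close>

text \<open>Only the values of the structure maps on \<open>Ob C\<close> and \<open>Arr C\<close> carry meaning; the composite
  \<open>g \<cdot> f\<close> is \<open>f\<close> followed by \<open>g\<close>.\<close>

record ('o, 'm) category =
  Ob :: "'o set"
  Arr :: "'m set"
  Dom :: "'m \<Rightarrow> 'o"
  Cod :: "'m \<Rightarrow> 'o"
  Ident :: "'o \<Rightarrow> 'm" (\<open>\<one>\<index>\<close>)
  Comp :: "'m \<Rightarrow> 'm \<Rightarrow> 'm" (infixr \<open>\<cdot>\<index>\<close> 55)

definition hom :: "('o, 'm, 'z) category_scheme \<Rightarrow> 'o \<Rightarrow> 'o \<Rightarrow> 'm set" where
  "hom C X Y = {f \<in> Arr C. Dom C f = X \<and> Cod C f = Y}"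

locale category =
  fixes C :: "('o, 'm, 'z) category_scheme" (structure)
  assumes dom_ob: "f \<in> Arr C \<Longrightarrow> Dom C f \<in> Ob C"
    and cod_ob: "f \<in> Arr C \<Longrightarrow> Cod C f \<in> Ob C"
    and id_hom: "X \<in> Ob C \<Longrightarrow> \<one> X \<in> hom C X X"
    and comp_hom: "\<lbrakk>f \<in> hom C X Y; g \<in> hom C Y Z\<rbrakk> \<Longrightarrow> g \<cdot> f \<in> hom C X Z"
    and comp_id_right: "f \<in> hom C X Y \<Longrightarrow> f \<cdot> \<one> X = f"
    and comp_id_left: "f \<in> hom C X Y \<Longrightarrow> \<one> Y \<cdot> f = f"
    and comp_assoc: "\<lbrakk>f \<in> hom C W X; g \<in> hom C X Y; h \<in> hom C Y Z\<rbrakk>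
      \<Longrightarrow> (h \<cdot> g) \<cdot> f = h \<cdot> (g \<cdot> f)"

definition is_iso :: "('o, 'm, 'z) category_scheme \<Rightarrow> 'm \<Rightarrow> bool" where
  "is_iso C f \<longleftrightarrow> f \<in> Arr C \<and>
     (\<exists>g \<in> hom C (Cod C f) (Dom C f).
        g \<cdot>\<^bsub>C\<^esub> f = \<one>\<^bsub>C\<^esub> (Dom C f) \<and> f \<cdot>\<^bsub>C\<^esub> g = \<one>\<^bsub>C\<^esub> (Cod C f))"

definition isomorphic :: "('o, 'm, 'z) category_scheme \<Rightarrow> 'o \<Rightarrow> 'o \<Rightarrow> bool" where
  "isomorphic C X Y \<longleftrightarrow> (\<exists>f \<in> hom C X Y. is_iso C f)"

record ('o1, 'm1, 'o2, 'm2) cfunctor =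
  ob :: "'o1 \<Rightarrow> 'o2"
  ar :: "'m1 \<Rightarrow> 'm2"

locale cat_functor = source: category A + target: category B
  for A :: "('o1, 'm1, 'z1) category_scheme"
    and B :: "('o2, 'm2, 'z2) category_scheme"
    and F :: "('o1, 'm1, 'o2, 'm2) cfunctor" +
  assumes map_ob: "X \<in> Ob A \<Longrightarrow> ob F X \<in> Ob B"
    and map_hom: "f \<in> hom A X Y \<Longrightarrow> ar F f \<in> hom B (ob F X) (ob F Y)"
    and map_id: "X \<in> Ob A \<Longrightarrow> ar F (\<one>\<^bsub>A\<^esub> X) = \<one>\<^bsub>B\<^esub> (ob F X)"
    and map_comp: "\<lbrakk>f \<in> hom A X Y; g \<in> hom A Y Z\<rbrakk>
      \<Longrightarrow> ar F (g \<cdot>\<^bsub>A\<^esub> f) = ar F g \<cdot>\<^bsub>B\<^esub> ar F f"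

definition id_functor :: "('o, 'm, 'o, 'm) cfunctor" where
  "id_functor = \<lparr>ob = (\<lambda>X. X), ar = (\<lambda>f. f)\<rparr>"

definition comp_functor ::
  "('o2, 'm2, 'o3, 'm3) cfunctor \<Rightarrow> ('o1, 'm1, 'o2, 'm2) cfunctor \<Rightarrow> ('o1, 'm1, 'o3, 'm3) cfunctor"
  where "comp_functor G F = \<lparr>ob = ob G \<circ> ob F, ar = ar G \<circ> ar F\<rparr>"

locale nat_trans = dom: cat_functor A B F + cod: cat_functor A B G
  for A :: "('o1, 'm1, 'z1) category_scheme"
    and B :: "('o2, 'm2, 'z2) category_scheme"
    and F G :: "('o1, 'm1, 'o2, 'm2) cfunctor"
    and t :: "'o1 \<Rightarrow> 'm2" +
  assumes component: "X \<in> Ob A \<Longrightarrow> t X \<in> hom B (ob F X) (ob G X)"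
    and naturality: "f \<in> hom A X Y \<Longrightarrow> t Y \<cdot>\<^bsub>B\<^esub> ar F f = ar G f \<cdot>\<^bsub>B\<^esub> t X"

locale adjunction = left: cat_functor A B F + right: cat_functor B A G +
    unit: nat_trans A A id_functor "comp_functor G F" u +
    counit: nat_trans B B "comp_functor F G" id_functor c
  for A :: "('o1, 'm1, 'z1) category_scheme"
    and B :: "('o2, 'm2, 'z2) category_scheme"
    and F :: "('o1, 'm1, 'o2, 'm2) cfunctor"
    and G :: "('o2, 'm2, 'o1, 'm1) cfunctor"
    and u :: "'o1 \<Rightarrow> 'm1" and c :: "'o2 \<Rightarrow> 'm2" +
  assumes triangle_left: "X \<in> Ob A \<Longrightarrow> c (ob F X) \<cdot>\<^bsub>B\<^esub> ar F (u X) = \<one>\<^bsub>B\<^esub> (ob F X)"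
    and triangle_right: "Y \<in> Ob B \<Longrightarrow> ar G (c Y) \<cdot>\<^bsub>A\<^esub> u (ob G Y) = \<one>\<^bsub>A\<^esub> (ob G Y)"


section \<open>Small colimits\<close>

definition is_cocone ::
  "('j, 'k, 'y) category_scheme \<Rightarrow> ('o, 'm, 'z) category_scheme \<Rightarrow> ('j, 'k, 'o, 'm) cfunctor
    \<Rightarrow> 'o \<Rightarrow> ('j \<Rightarrow> 'm) \<Rightarrow> bool" where
  "is_cocone J C D X k \<longleftrightarrow> X \<in> Ob C \<and> (\<forall>j \<in> Ob J. k j \<in> hom C (ob D j) X) \<and>
     (\<forall>f \<in> Arr J. k (Cod J f) \<cdot>\<^bsub>C\<^esub> ar D f = k (Dom J f))"

definition is_colimit ::
  "('j, 'k, 'y) category_scheme \<Rightarrow> ('o, 'm, 'z) category_scheme \<Rightarrow> ('j, 'k, 'o, 'm) cfunctor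
    \<Rightarrow> 'o \<Rightarrow> ('j \<Rightarrow> 'm) \<Rightarrow> bool" where
  "is_colimit J C D X k \<longleftrightarrow> is_cocone J C D X k \<and>
     (\<forall>Y k'. is_cocone J C D Y k' \<longrightarrow>
        (\<exists>!h. h \<in> hom C X Y \<and> (\<forall>j \<in> Ob J. h \<cdot>\<^bsub>C\<^esub> k j = k' j)))"

text \<open>HOL has no distinguished universe of small sets, so smallness is relative to a type \<open>'k\<close>: an
  index category is small when its objects and arrows are elements of \<open>'k\<close>. The category \<open>C\<close>
  itself may live in larger types.\<close>

definition cocomplete :: "'k itself \<Rightarrow> ('o, 'm, 'z) category_scheme \<Rightarrow> bool" where
  "cocomplete (_ :: 'k itself) C \<longleftrightarrow>
     (\<forall>(J :: ('k, 'k) category) D. cat_functor J C D \<longrightarrow> (\<exists>X k. is_colimit J C D X k))"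


section \<open>Closed symmetric monoidal categories\<close>

text \<open>\<open>\<otimes>\<close> is the tensor product on objects and \<open>\<boxtimes>\<close> its action on morphisms.\<close>

record ('o, 'm) symmetric_monoidal_category = "('o, 'm) category" +
  Tens :: "'o \<Rightarrow> 'o \<Rightarrow> 'o" (infixr \<open>\<otimes>\<index>\<close> 70)
  TensArr :: "'m \<Rightarrow> 'm \<Rightarrow> 'm" (infixr \<open>\<boxtimes>\<index>\<close> 70)
  Unit :: 'o
  Assoc :: "'o \<Rightarrow> 'o \<Rightarrow> 'o \<Rightarrow> 'm"
  LUnit :: "'o \<Rightarrow> 'm"
  RUnit :: "'o \<Rightarrow> 'm"
  Swap :: "'o \<Rightarrow> 'o \<Rightarrow> 'm"

text \<open>The coherence axioms are those of Mac Lane, which list two conditions on the unit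
  (\<open>unitors_agree\<close>, \<open>swap_unit\<close>) that are in fact consequences of the others.\<close>

locale symmetric_monoidal_category = category C
  for C :: "('o, 'm, 'z) symmetric_monoidal_category_scheme" (structure) +
  assumes unit_ob: "Unit C \<in> Ob C"
    and tens_ob: "\<lbrakk>X \<in> Ob C; Y \<in> Ob C\<rbrakk> \<Longrightarrow> X \<otimes> Y \<in> Ob C"
    and tens_hom: "\<lbrakk>f \<in> hom C X X'; g \<in> hom C Y Y'\<rbrakk> \<Longrightarrow> f \<boxtimes> g \<in> hom C (X \<otimes> Y) (X' \<otimes> Y')"
    and tens_id: "\<lbrakk>X \<in> Ob C; Y \<in> Ob C\<rbrakk> \<Longrightarrow> \<one> X \<boxtimes> \<one> Y = \<one> (X \<otimes> Y)"
    and tens_comp: "\<lbrakk>f \<in> hom C X X'; f' \<in> hom C X' X''; g \<in> hom C Y Y'; g' \<in> hom C Y' Y''\<rbrakk>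
      \<Longrightarrow> (f' \<cdot> f) \<boxtimes> (g' \<cdot> g) = (f' \<boxtimes> g') \<cdot> (f \<boxtimes> g)"
    and assoc_hom: "\<lbrakk>X \<in> Ob C; Y \<in> Ob C; Z \<in> Ob C\<rbrakk>
      \<Longrightarrow> Assoc C X Y Z \<in> hom C ((X \<otimes> Y) \<otimes> Z) (X \<otimes> (Y \<otimes> Z))"
    and assoc_iso: "\<lbrakk>X \<in> Ob C; Y \<in> Ob C; Z \<in> Ob C\<rbrakk> \<Longrightarrow> is_iso C (Assoc C X Y Z)"
    and assoc_nat: "\<lbrakk>f \<in> hom C X X'; g \<in> hom C Y Y'; h \<in> hom C Z Z'\<rbrakk>
      \<Longrightarrow> Assoc C X' Y' Z' \<cdot> ((f \<boxtimes> g) \<boxtimes> h) = (f \<boxtimes> (g \<boxtimes> h)) \<cdot> Assoc C X Y Z"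
    and lunit_hom: "X \<in> Ob C \<Longrightarrow> LUnit C X \<in> hom C (Unit C \<otimes> X) X"
    and lunit_iso: "X \<in> Ob C \<Longrightarrow> is_iso C (LUnit C X)"
    and lunit_nat: "f \<in> hom C X Y \<Longrightarrow> LUnit C Y \<cdot> (\<one> (Unit C) \<boxtimes> f) = f \<cdot> LUnit C X"
    and runit_hom: "X \<in> Ob C \<Longrightarrow> RUnit C X \<in> hom C (X \<otimes> Unit C) X"
    and runit_iso: "X \<in> Ob C \<Longrightarrow> is_iso C (RUnit C X)"
    and runit_nat: "f \<in> hom C X Y \<Longrightarrow> RUnit C Y \<cdot> (f \<boxtimes> \<one> (Unit C)) = f \<cdot> RUnit C X"
    and pentagon: "\<lbrakk>W \<in> Ob C; X \<in> Ob C; Y \<in> Ob C; Z \<in> Ob C\<rbrakk>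
      \<Longrightarrow> Assoc C W X (Y \<otimes> Z) \<cdot> Assoc C (W \<otimes> X) Y Z
        = (\<one> W \<boxtimes> Assoc C X Y Z) \<cdot> Assoc C W (X \<otimes> Y) Z \<cdot> (Assoc C W X Y \<boxtimes> \<one> Z)"
    and triangle: "\<lbrakk>X \<in> Ob C; Y \<in> Ob C\<rbrakk>
      \<Longrightarrow> (\<one> X \<boxtimes> LUnit C Y) \<cdot> Assoc C X (Unit C) Y = RUnit C X \<boxtimes> \<one> Y"
    and unitors_agree: "LUnit C (Unit C) = RUnit C (Unit C)"
    and swap_hom: "\<lbrakk>X \<in> Ob C; Y \<in> Ob C\<rbrakk> \<Longrightarrow> Swap C X Y \<in> hom C (X \<otimes> Y) (Y \<otimes> X)"
    and swap_nat: "\<lbrakk>f \<in> hom C X X'; g \<in> hom C Y Y'\<rbrakk>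
      \<Longrightarrow> Swap C X' Y' \<cdot> (f \<boxtimes> g) = (g \<boxtimes> f) \<cdot> Swap C X Y"
    and swap_swap: "\<lbrakk>X \<in> Ob C; Y \<in> Ob C\<rbrakk> \<Longrightarrow> Swap C Y X \<cdot> Swap C X Y = \<one> (X \<otimes> Y)"
    and swap_unit: "X \<in> Ob C \<Longrightarrow> LUnit C X \<cdot> Swap C X (Unit C) = RUnit C X"
    and hexagon: "\<lbrakk>X \<in> Ob C; Y \<in> Ob C; Z \<in> Ob C\<rbrakk>
      \<Longrightarrow> Assoc C Y Z X \<cdot> Swap C X (Y \<otimes> Z) \<cdot> Assoc C X Y Z
        = (\<one> Y \<boxtimes> Swap C X Z) \<cdot> Assoc C Y X Z \<cdot> (Swap C X Y \<boxtimes> \<one> Z)"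

record ('o, 'm) closed_symmetric_monoidal_category = "('o, 'm) symmetric_monoidal_category" +
  IHom :: "'o \<Rightarrow> 'o \<Rightarrow> 'o"
  Ev :: "'o \<Rightarrow> 'o \<Rightarrow> 'm"

text \<open>\<open>IHom C X\<close> is right adjoint to \<open>- \<otimes> X\<close>, the adjunction being given by its counit \<open>Ev C X\<close>.\<close>

locale closed_symmetric_monoidal_category = symmetric_monoidal_category C
  for C :: "('o, 'm, 'z) closed_symmetric_monoidal_category_scheme" (structure) +
  assumes ihom_ob: "\<lbrakk>X \<in> Ob C; Y \<in> Ob C\<rbrakk> \<Longrightarrow> IHom C X Y \<in> Ob C"
    and ev_hom: "\<lbrakk>X \<in> Ob C; Y \<in> Ob C\<rbrakk> \<Longrightarrow> Ev C X Y \<in> hom C (IHom C X Y \<otimes> X) Y"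
    and ev_universal: "\<lbrakk>A \<in> Ob C; X \<in> Ob C; Y \<in> Ob C; f \<in> hom C (A \<otimes> X) Y\<rbrakk>
      \<Longrightarrow> \<exists>!g. g \<in> hom C A (IHom C X Y) \<and> Ev C X Y \<cdot> (g \<boxtimes> \<one> X) = f"

definition transpose ::
  "('o, 'm, 'z) closed_symmetric_monoidal_category_scheme \<Rightarrow> 'o \<Rightarrow> 'o \<Rightarrow> 'o \<Rightarrow> 'm \<Rightarrow> 'm" where
  "transpose C A X Y f =
     (THE g. g \<in> hom C A (IHom C X Y) \<and> Ev C X Y \<cdot>\<^bsub>C\<^esub> (g \<boxtimes>\<^bsub>C\<^esub> \<one>\<^bsub>C\<^esub> X) = f)"

text \<open>The morphism \<open>IHom C Y Z \<rightarrow> IHom C X Z\<close> induced by \<open>f : X \<rightarrow> Y\<close>, i.e. the action of the internal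
  hom on morphisms in its contravariant variable.\<close>

definition ihom_pre ::
  "('o, 'm, 'z) closed_symmetric_monoidal_category_scheme \<Rightarrow> 'm \<Rightarrow> 'o \<Rightarrow> 'm" where
  "ihom_pre C f Z =
     transpose C (IHom C (Cod C f) Z) (Dom C f) Z
       (Ev C (Cod C f) Z \<cdot>\<^bsub>C\<^esub> (\<one>\<^bsub>C\<^esub> (IHom C (Cod C f) Z) \<boxtimes>\<^bsub>C\<^esub> f))"


section \<open>Closed symmetric monoidal \<open>V\<close>-categories\<close>

locale strong_symmetric_monoidal_functor =
    source: symmetric_monoidal_category A + target: symmetric_monoidal_category B +
    cat_functor A B F
  for A :: "('o1, 'm1, 'z1) symmetric_monoidal_category_scheme"
    and B :: "('o2, 'm2, 'z2) symmetric_monoidal_category_scheme"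
    and F :: "('o1, 'm1, 'o2, 'm2) cfunctor"
    and m :: "'o1 \<Rightarrow> 'o1 \<Rightarrow> 'm2" and m0 :: 'm2 +
  assumes m_hom: "\<lbrakk>X \<in> Ob A; Y \<in> Ob A\<rbrakk>
      \<Longrightarrow> m X Y \<in> hom B (ob F X \<otimes>\<^bsub>B\<^esub> ob F Y) (ob F (X \<otimes>\<^bsub>A\<^esub> Y))"
    and m_iso: "\<lbrakk>X \<in> Ob A; Y \<in> Ob A\<rbrakk> \<Longrightarrow> is_iso B (m X Y)"
    and m_nat: "\<lbrakk>f \<in> hom A X X'; g \<in> hom A Y Y'\<rbrakk>
      \<Longrightarrow> m X' Y' \<cdot>\<^bsub>B\<^esub> (ar F f \<boxtimes>\<^bsub>B\<^esub> ar F g) = ar F (f \<boxtimes>\<^bsub>A\<^esub> g) \<cdot>\<^bsub>B\<^esub> m X Y"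
    and m0_hom: "m0 \<in> hom B (Unit B) (ob F (Unit A))"
    and m0_iso: "is_iso B m0"
    and m_assoc: "\<lbrakk>X \<in> Ob A; Y \<in> Ob A; Z \<in> Ob A\<rbrakk>
      \<Longrightarrow> ar F (Assoc A X Y Z) \<cdot>\<^bsub>B\<^esub> m (X \<otimes>\<^bsub>A\<^esub> Y) Z \<cdot>\<^bsub>B\<^esub> (m X Y \<boxtimes>\<^bsub>B\<^esub> \<one>\<^bsub>B\<^esub> (ob F Z))
        = m X (Y \<otimes>\<^bsub>A\<^esub> Z) \<cdot>\<^bsub>B\<^esub> (\<one>\<^bsub>B\<^esub> (ob F X) \<boxtimes>\<^bsub>B\<^esub> m Y Z)
            \<cdot>\<^bsub>B\<^esub> Assoc B (ob F X) (ob F Y) (ob F Z)"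
    and m_lunit: "X \<in> Ob A
      \<Longrightarrow> ar F (LUnit A X) \<cdot>\<^bsub>B\<^esub> m (Unit A) X \<cdot>\<^bsub>B\<^esub> (m0 \<boxtimes>\<^bsub>B\<^esub> \<one>\<^bsub>B\<^esub> (ob F X)) = LUnit B (ob F X)"
    and m_runit: "X \<in> Ob A
      \<Longrightarrow> ar F (RUnit A X) \<cdot>\<^bsub>B\<^esub> m X (Unit A) \<cdot>\<^bsub>B\<^esub> (\<one>\<^bsub>B\<^esub> (ob F X) \<boxtimes>\<^bsub>B\<^esub> m0) = RUnit B (ob F X)"
    and m_swap: "\<lbrakk>X \<in> Ob A; Y \<in> Ob A\<rbrakk>
      \<Longrightarrow> ar F (Swap A X Y) \<cdot>\<^bsub>B\<^esub> m X Y = m Y X \<cdot>\<^bsub>B\<^esub> Swap B (ob F X) (ob F Y)"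

locale closed_symmetric_monoidal_V_category =
    base: symmetric_monoidal_category V + closed_symmetric_monoidal_category E +
    adjunction V E i r u c + strong_symmetric_monoidal_functor V E i m m0
  for V :: "('vo, 'vm, 'y) symmetric_monoidal_category_scheme"
    and E :: "('o, 'm, 'z) closed_symmetric_monoidal_category_scheme"
    and i :: "('vo, 'vm, 'o, 'm) cfunctor" and r :: "('o, 'm, 'vo, 'vm) cfunctor"
    and u :: "'vo \<Rightarrow> 'vm" and c :: "'o \<Rightarrow> 'm"
    and m :: "'vo \<Rightarrow> 'vo \<Rightarrow> 'm" and m0 :: 'm

text \<open>The morphism \<open>f\<^sup>* : Hom(Y, Z) \<rightarrow> Hom(X, Z)\<close> of \<open>V\<close> induced by \<open>f : X \<rightarrow> Y\<close> in \<open>E\<close>, where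
  \<open>Hom(X, Z) = ob r (IHom E X Z)\<close>.\<close>

definition pullback ::
  "('o, 'm, 'z) closed_symmetric_monoidal_category_scheme \<Rightarrow> ('o, 'm, 'vo, 'vm) cfunctor
    \<Rightarrow> 'm \<Rightarrow> 'o \<Rightarrow> 'vm" where
  "pullback E r f Z = ar r (ihom_pre E f Z)"


section \<open>Localization functors\<close>

definition localization_functor ::
  "('o, 'm, 'z) category_scheme \<Rightarrow> ('o, 'm, 'o, 'm) cfunctor \<Rightarrow> ('o \<Rightarrow> 'm) \<Rightarrow> bool" where
  "localization_functor E L l \<longleftrightarrow> nat_trans E E id_functor L l \<and>
     (\<forall>X \<in> Ob E. l (ob L X) = ar L (l X) \<and> is_iso E (l (ob L X)))"

definition local_objects ::
  "('o, 'm, 'z) category_scheme \<Rightarrow> ('o, 'm, 'o, 'm) cfunctor \<Rightarrow> 'o set" where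
  "local_objects E L = {Z \<in> Ob E. \<exists>X \<in> Ob E. isomorphic E Z (ob L X)}"

definition local_equivalences ::
  "('o, 'm, 'z) category_scheme \<Rightarrow> ('o, 'm, 'o, 'm) cfunctor \<Rightarrow> 'm set" where
  "local_equivalences E L = {f \<in> Arr E. is_iso E (ar L f)}"

definition ir_localization_functor ::
  "('vo, 'vm, 'y) category_scheme \<Rightarrow> ('o, 'm, 'z) closed_symmetric_monoidal_category_scheme
    \<Rightarrow> ('o, 'm, 'vo, 'vm) cfunctor \<Rightarrow> ('o, 'm, 'o, 'm) cfunctor \<Rightarrow> ('o \<Rightarrow> 'm) \<Rightarrow> bool" where
  "ir_localization_functor V E r L l \<longleftrightarrow> localization_functor E L l \<and>
     (\<forall>f \<in> local_equivalences E L. \<forall>Z \<in> local_objects E L. is_iso V (pullback E r f Z))"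

definition class_local_objects ::
  "('vo, 'vm, 'y) category_scheme \<Rightarrow> ('o, 'm, 'z) closed_symmetric_monoidal_category_scheme
    \<Rightarrow> ('o, 'm, 'vo, 'vm) cfunctor \<Rightarrow> 'm set \<Rightarrow> 'o set" where
  "class_local_objects V E r S = {Z \<in> Ob E. \<forall>f \<in> S. is_iso V (pullback E r f Z)}"

definition class_local_equivalences ::
  "('vo, 'vm, 'y) category_scheme \<Rightarrow> ('o, 'm, 'z) closed_symmetric_monoidal_category_scheme
    \<Rightarrow> ('o, 'm, 'vo, 'vm) cfunctor \<Rightarrow> 'm set \<Rightarrow> 'm set" where
  "class_local_equivalences V E r S =
     {g \<in> Arr E. \<forall>Z \<in> class_local_objects V E r S. is_iso V (pullback E r g Z)}"

definition ir_class_localization_functor ::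
  "('vo, 'vm, 'y) category_scheme \<Rightarrow> ('o, 'm, 'z) closed_symmetric_monoidal_category_scheme
    \<Rightarrow> ('o, 'm, 'vo, 'vm) cfunctor \<Rightarrow> 'm set
    \<Rightarrow> ('o, 'm, 'o, 'm) cfunctor \<Rightarrow> ('o \<Rightarrow> 'm) \<Rightarrow> bool" where
  "ir_class_localization_functor V E r S L l \<longleftrightarrow> ir_localization_functor V E r L l \<and>
     local_objects E L = class_local_objects V E r S \<and>
     local_equivalences E L = class_local_equivalences V E r S"


section \<open>Monoids\<close>

record ('o, 'm) mon =
  Carrier :: 'o
  Mult :: 'm
  Eta :: 'm

definition is_monoid ::
  "('o, 'm, 'z) symmetric_monoidal_category_scheme \<Rightarrow> ('o, 'm) mon \<Rightarrow> bool" where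
  "is_monoid E R \<longleftrightarrow> Carrier R \<in> Ob E \<and>
     Mult R \<in> hom E (Carrier R \<otimes>\<^bsub>E\<^esub> Carrier R) (Carrier R) \<and>
     Eta R \<in> hom E (Unit E) (Carrier R) \<and>
     Mult R \<cdot>\<^bsub>E\<^esub> (Mult R \<boxtimes>\<^bsub>E\<^esub> \<one>\<^bsub>E\<^esub> (Carrier R))
       = Mult R \<cdot>\<^bsub>E\<^esub> (\<one>\<^bsub>E\<^esub> (Carrier R) \<boxtimes>\<^bsub>E\<^esub> Mult R)
           \<cdot>\<^bsub>E\<^esub> Assoc E (Carrier R) (Carrier R) (Carrier R) \<and>
     Mult R \<cdot>\<^bsub>E\<^esub> (Eta R \<boxtimes>\<^bsub>E\<^esub> \<one>\<^bsub>E\<^esub> (Carrier R)) = LUnit E (Carrier R) \<and>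
     Mult R \<cdot>\<^bsub>E\<^esub> (\<one>\<^bsub>E\<^esub> (Carrier R) \<boxtimes>\<^bsub>E\<^esub> Eta R) = RUnit E (Carrier R)"

definition monoid_morphism ::
  "('o, 'm, 'z) symmetric_monoidal_category_scheme \<Rightarrow> ('o, 'm) mon \<Rightarrow> ('o, 'm) mon \<Rightarrow> 'm \<Rightarrow> bool"
  where
  "monoid_morphism E R S f \<longleftrightarrow> f \<in> hom E (Carrier R) (Carrier S) \<and>
     f \<cdot>\<^bsub>E\<^esub> Mult R = Mult S \<cdot>\<^bsub>E\<^esub> (f \<boxtimes>\<^bsub>E\<^esub> f) \<and>
     f \<cdot>\<^bsub>E\<^esub> Eta R = Eta S"

definition monoid_isomorphic ::
  "('o, 'm, 'z) symmetric_monoidal_category_scheme \<Rightarrow> ('o, 'm) mon \<Rightarrow> ('o, 'm) mon \<Rightarrow> bool" where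
  "monoid_isomorphic E R S \<longleftrightarrow> (\<exists>f. monoid_morphism E R S f \<and> is_iso E f)"

definition unit_monoid :: "('o, 'm, 'z) symmetric_monoidal_category_scheme \<Rightarrow> ('o, 'm) mon" where
  "unit_monoid E = \<lparr>Carrier = Unit E, Mult = LUnit E (Unit E), Eta = \<one>\<^bsub>E\<^esub> (Unit E)\<rparr>"

definition ir_rigid ::
  "('vo, 'vm, 'y) category_scheme \<Rightarrow> ('o, 'm, 'z) closed_symmetric_monoidal_category_scheme
    \<Rightarrow> ('o, 'm, 'vo, 'vm) cfunctor \<Rightarrow> ('o, 'm) mon \<Rightarrow> bool" where
  "ir_rigid V E r R \<longleftrightarrow> is_monoid E R \<and> is_iso V (pullback E r (Eta R) (Carrier R))"

text \<open>\<open>R\<close> is the object \<open>L I\<close> equipped with a monoid structure for which \<open>l\<^sub>I : I \<rightarrow> L I\<close> is a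
  morphism of monoids.\<close>

definition localized_unit_monoid ::
  "('o, 'm, 'z) symmetric_monoidal_category_scheme \<Rightarrow> ('o, 'm, 'o, 'm) cfunctor \<Rightarrow> ('o \<Rightarrow> 'm)
    \<Rightarrow> ('o, 'm) mon \<Rightarrow> bool" where
  "localized_unit_monoid E L l R \<longleftrightarrow> Carrier R = ob L (Unit E) \<and> is_monoid E R \<and>
     monoid_morphism E (unit_monoid E) R (l (Unit E))"

end

theory Submission imports Defs begin

text \<open>Write \<open>I\<close> for the unit of \<open>E\<close>. Both directions turn on local equivalences from \<open>I\<close> into a local
  object: localization supplies one, and the unit of a rigid monoid becomes one once it is inverted.

  For an \<open>(i, r)\<close>-localization \<open>(L, l)\<close>, the morphism \<open>l\<^sub>I : I \<rightarrow> L I\<close> is a local equivalence into a local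
  object, so pullback along it, \<open>Hom(L I, L I) \<rightarrow> Hom(I, L I)\<close>, is invertible. Rigidity of a monoid
  structure with unit \<open>l\<^sub>I\<close> is exactly this. Existence and uniqueness of the structure need more than
  maps out of \<open>I\<close> and \<open>L I\<close>. Maps \<open>A \<rightarrow> Hom(X, Z)\<close> in \<open>V\<close> correspond to maps \<open>i A \<otimes> X \<rightarrow> Z\<close> in \<open>E\<close>, so
  the invertible pullback says that every map \<open>W \<otimes> I \<rightarrow> L I\<close> extends uniquely along \<open>W \<otimes> l\<^sub>I\<close> whenever
  \<open>W\<close> is isomorphic to an object in the image of \<open>i\<close> (\<open>orthogonal_localization_unit\<close>). As \<open>i\<close> is strong
  monoidal and \<open>L I \<cong> i B\<close>, this applies to \<open>W = I\<close>, \<open>W = L I\<close> and \<open>W = L I \<otimes> L I\<close>. The second choice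
  forces and provides the multiplication, as the unique extension of the right unitor; the first
  gives the left unit law and the third associativity (\<open>unique_monoid_if_orthogonal\<close>).

  Conversely, let \<open>R\<close> be a rigid monoid with unit \<open>\<eta>\<close>, and let \<open>L\<close> be the localization with respect to
  the single morphism \<open>\<eta>\<close>. Rigidity says that \<open>R\<close> is \<open>{\<eta>}\<close>-local, and \<open>\<eta>\<close> is trivially an \<open>{\<eta>}\<close>-local
  equivalence. A local equivalence \<open>I \<rightarrow> R\<close> into a local object is a localization of \<open>I\<close>, so there is an
  isomorphism \<open>\<phi> : R \<rightarrow> L I\<close> with \<open>\<phi> \<cdot> \<eta> = l\<^sub>I\<close> (\<open>local_equivalence_to_local_object\<close>). Transporting
  the monoid structure along \<open>\<phi>\<close> gives one on \<open>L I\<close> with unit \<open>l\<^sub>I\<close> (\<open>monoid_transport\<close>).\<close>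

section \<open>Isomorphisms and orthogonality\<close>

context category
begin

lemma homD:
  assumes "f \<in> hom C X Y"
  shows "f \<in> Arr C" "Dom C f = X" "Cod C f = Y" "X \<in> Ob C" "Y \<in> Ob C"
  using assms dom_ob cod_ob by (auto simp: hom_def)

lemma is_isoI:
  assumes "f \<in> hom C X Y" "g \<in> hom C Y X" "g \<cdot> f = \<one> X" "f \<cdot> g = \<one> Y"
  shows "is_iso C f"
  using assms homD[OF assms(1)] by (auto simp: is_iso_def)

lemma is_isoE:
  assumes "is_iso C f" "f \<in> hom C X Y"
  obtains g where "g \<in> hom C Y X" "g \<cdot> f = \<one> X" "f \<cdot> g = \<one> Y"
  using assms homD[OF assms(2)] by (auto simp: is_iso_def)

lemma isomorphicE:
  assumes "isomorphic C X Y"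
  obtains f g where "f \<in> hom C X Y" "g \<in> hom C Y X" "g \<cdot> f = \<one> X" "f \<cdot> g = \<one> Y"
  using assms is_isoE unfolding isomorphic_def by metis

lemma isomorphicI:
  assumes "f \<in> hom C X Y" "g \<in> hom C Y X" "g \<cdot> f = \<one> X" "f \<cdot> g = \<one> Y"
  shows "isomorphic C X Y"
  using assms is_isoI unfolding isomorphic_def by metis

lemma isomorphic_refl: "X \<in> Ob C \<Longrightarrow> isomorphic C X X"
  using isomorphicI[of "\<one> X" X X "\<one> X"] id_hom comp_id_left by metis

lemma id_iso: "X \<in> Ob C \<Longrightarrow> is_iso C (\<one> X)"
  using is_isoI[of "\<one> X" X X "\<one> X"] id_hom comp_id_left by metis

lemma cancel_left_inverse:
  assumes "f \<in> hom C X Y" "g \<in> hom C Y X" "g \<cdot> f = \<one> X" "h \<in> hom C W X"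
  shows "g \<cdot> (f \<cdot> h) = h"
  using assms comp_assoc[OF assms(4) assms(1) assms(2)] comp_id_left by metis

lemma cancel_right_inverse:
  assumes "f \<in> hom C X Y" "g \<in> hom C Y X" "g \<cdot> f = \<one> X" "h \<in> hom C X Z"
  shows "(h \<cdot> g) \<cdot> f = h"
  using assms comp_assoc[OF assms(1) assms(2) assms(4)] comp_id_right by metis

lemma iso_comp:
  assumes f: "f \<in> hom C X Y" "is_iso C f" and g: "g \<in> hom C Y Z" "is_iso C g"
  shows "is_iso C (g \<cdot> f)"
proof -
  obtain f' where f': "f' \<in> hom C Y X" "f' \<cdot> f = \<one> X" "f \<cdot> f' = \<one> Y"
    using is_isoE f by blast
  obtain g' where g': "g' \<in> hom C Z Y" "g' \<cdot> g = \<one> Y" "g \<cdot> g' = \<one> Z"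
    using is_isoE g by blast
  have gf: "g \<cdot> f \<in> hom C X Z" and fg': "f' \<cdot> g' \<in> hom C Z X"
    using comp_hom f g f' g' by blast+
  have "(f' \<cdot> g') \<cdot> (g \<cdot> f) = \<one> X"
    using comp_assoc[OF gf g'(1) f'(1)] cancel_left_inverse[OF g(1) g'(1,2) f(1)] f'(2) by simp
  moreover have "(g \<cdot> f) \<cdot> (f' \<cdot> g') = \<one> Z"
    using comp_assoc[OF fg' f(1) g(1)] cancel_left_inverse[OF f'(1) f(1) f'(3) g'(1)] g'(3) by simp
  ultimately show ?thesis
    using is_isoI[OF gf fg'] by blast
qed

end

text \<open>\<open>Z\<close> is orthogonal to \<open>f\<close> when every morphism from the domain of \<open>f\<close> to \<open>Z\<close> extends uniquely
  along \<open>f\<close>.\<close>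

definition orthogonal :: "('o, 'm, 'z) category_scheme \<Rightarrow> 'm \<Rightarrow> 'o \<Rightarrow> bool" where
  "orthogonal C f Z \<longleftrightarrow>
     bij_betw (\<lambda>k. k \<cdot>\<^bsub>C\<^esub> f) (hom C (Cod C f) Z) (hom C (Dom C f) Z)"

context category
begin

lemma orthogonalI:
  assumes f: "f \<in> hom C X Y"
    and inj: "\<And>h k. \<lbrakk>h \<in> hom C Y Z; k \<in> hom C Y Z; h \<cdot> f = k \<cdot> f\<rbrakk> \<Longrightarrow> h = k"
    and surj: "\<And>h. h \<in> hom C X Z \<Longrightarrow> \<exists>k \<in> hom C Y Z. k \<cdot> f = h"
  shows "orthogonal C f Z"
  unfolding orthogonal_def bij_betw_def inj_on_def
  using f inj surj homD[OF f] comp_hom[OF f] by (auto simp: image_iff) metis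

lemma orthogonal_unique:
  assumes "orthogonal C f Z" "f \<in> hom C X Y" "h \<in> hom C Y Z" "k \<in> hom C Y Z" "h \<cdot> f = k \<cdot> f"
  shows "h = k"
  using assms homD[OF assms(2)] unfolding orthogonal_def bij_betw_def inj_on_def by blast

lemma orthogonal_extend:
  assumes "orthogonal C f Z" "f \<in> hom C X Y" "h \<in> hom C X Z"
  obtains k where "k \<in> hom C Y Z" "k \<cdot> f = h"
proof -
  have "h \<in> (\<lambda>k. k \<cdot> f) ` hom C Y Z"
    using assms homD[OF assms(2)] by (simp add: orthogonal_def bij_betw_def)
  then show ?thesis using that by blast
qed

lemma orthogonal_iso_transfer:
  assumes orth: "orthogonal C f' Z"
    and f: "f \<in> hom C X Y" and f': "f' \<in> hom C X' Y'"
    and a: "a \<in> hom C X X'" "is_iso C a" and b: "b \<in> hom C Y Y'" "is_iso C b"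
    and square: "f' \<cdot> a = b \<cdot> f"
  shows "orthogonal C f Z"
proof -
  obtain a' where a': "a' \<in> hom C X' X" "a' \<cdot> a = \<one> X" "a \<cdot> a' = \<one> X'"
    using is_isoE a by blast
  obtain b' where b': "b' \<in> hom C Y' Y" "b' \<cdot> b = \<one> Y" "b \<cdot> b' = \<one> Y'"
    using is_isoE b by blast
  have transport: "((k \<cdot> b') \<cdot> f') \<cdot> a = k \<cdot> f" if k: "k \<in> hom C Y Z" for k
  proof -
    have "k \<cdot> b' \<in> hom C Y' Z" using comp_hom b' k by blast
    then have "((k \<cdot> b') \<cdot> f') \<cdot> a = (k \<cdot> b') \<cdot> (b \<cdot> f)"
      using comp_assoc[OF a(1) f'] square by metis
    also have "\<dots> = k \<cdot> f"
      using comp_assoc[OF f b(1)] \<open>k \<cdot> b' \<in> hom C Y' Z\<close> cancel_right_inverse[OF b(1) b'(1,2) k]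
      by metis
    finally show ?thesis .
  qed
  show ?thesis
  proof (rule orthogonalI[OF f])
    fix h k assume h: "h \<in> hom C Y Z" and k: "k \<in> hom C Y Z" and eq: "h \<cdot> f = k \<cdot> f"
    have hb: "h \<cdot> b' \<in> hom C Y' Z" "k \<cdot> b' \<in> hom C Y' Z"
      using comp_hom b' h k by blast+
    have "((h \<cdot> b') \<cdot> f') \<cdot> a = ((k \<cdot> b') \<cdot> f') \<cdot> a"
      using transport h k eq by simp
    then have "(h \<cdot> b') \<cdot> f' = (k \<cdot> b') \<cdot> f'"
      using cancel_right_inverse[OF a'(1) a(1) a'(3)] comp_hom[OF f'] hb by metis
    then have "h \<cdot> b' = k \<cdot> b'"
      using orthogonal_unique[OF orth f'] hb by blast
    then show "h = k"
      using cancel_right_inverse[OF b(1) b'(1,2)] h k by metis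
  next
    fix h assume h: "h \<in> hom C X Z"
    have "h \<cdot> a' \<in> hom C X' Z" using comp_hom a' h by blast
    then obtain k where k: "k \<in> hom C Y' Z" "k \<cdot> f' = h \<cdot> a'"
      using orthogonal_extend[OF orth f'] by blast
    have kb: "k \<cdot> b \<in> hom C Y Z" using comp_hom b k by blast
    have "(k \<cdot> b) \<cdot> f = ((k \<cdot> f') \<cdot> a)"
      using comp_assoc[OF f b(1) k(1)] comp_assoc[OF a(1) f' k(1)] square by metis
    also have "\<dots> = h"
      using k cancel_right_inverse[OF a(1) a'(1,2) h] by simp
    finally show "\<exists>k \<in> hom C Y Z. k \<cdot> f = h" using kb by blast
  qed
qed

end

section \<open>Functors and adjunctions\<close>

context cat_functor
begin

lemma map_iso:
  assumes "is_iso A f" "f \<in> hom A X Y"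
  shows "is_iso B (ar F f)"
proof -
  obtain g where g: "g \<in> hom A Y X" "g \<cdot>\<^bsub>A\<^esub> f = \<one>\<^bsub>A\<^esub> X" "f \<cdot>\<^bsub>A\<^esub> g = \<one>\<^bsub>A\<^esub> Y"
    using source.is_isoE assms by blast
  have "ar F g \<cdot>\<^bsub>B\<^esub> ar F f = \<one>\<^bsub>B\<^esub> (ob F X)" "ar F f \<cdot>\<^bsub>B\<^esub> ar F g = \<one>\<^bsub>B\<^esub> (ob F Y)"
    using map_comp[OF assms(2) g(1)] map_comp[OF g(1) assms(2)] g map_id
      source.homD[OF assms(2)] by simp_all
  then show ?thesis
    using target.is_isoI map_hom assms(2) g(1) by blast
qed

end

context adjunction
begin

text \<open>A morphism out of \<open>ob F X\<close> is recovered from its adjunct; this is the left triangle identity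
  after naturality of the counit.\<close>

lemma left_adjunct_inverse:
  assumes X: "X \<in> Ob A" and w: "w \<in> hom B (ob F X) P"
  shows "c P \<cdot>\<^bsub>B\<^esub> ar F (ar G w \<cdot>\<^bsub>A\<^esub> u X) = w"
proof -
  have u: "u X \<in> hom A X (ob G (ob F X))"
    using unit.component[OF X] by (simp add: id_functor_def comp_functor_def)
  have P: "P \<in> Ob B" "ob F X \<in> Ob B" using left.target.homD[OF w] by auto
  have Fu: "ar F (u X) \<in> hom B (ob F X) (ob F (ob G (ob F X)))" using left.map_hom u by blast
  have Gw: "ar G w \<in> hom A (ob G (ob F X)) (ob G P)" using right.map_hom w by blast
  have cP: "c Q \<in> hom B (ob F (ob G Q)) Q" if "Q \<in> Ob B" for Q
    using counit.component[OF that] by (simp add: id_functor_def comp_functor_def)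
  have nat: "c P \<cdot>\<^bsub>B\<^esub> ar F (ar G w) = w \<cdot>\<^bsub>B\<^esub> c (ob F X)"
    using counit.naturality[OF w] by (simp add: id_functor_def comp_functor_def)
  have "c P \<cdot>\<^bsub>B\<^esub> ar F (ar G w \<cdot>\<^bsub>A\<^esub> u X) = (c P \<cdot>\<^bsub>B\<^esub> ar F (ar G w)) \<cdot>\<^bsub>B\<^esub> ar F (u X)"
    using left.map_comp[OF u Gw] left.target.comp_assoc[OF Fu left.map_hom[OF Gw] cP[OF P(1)]]
    by simp
  also have "\<dots> = w \<cdot>\<^bsub>B\<^esub> (c (ob F X) \<cdot>\<^bsub>B\<^esub> ar F (u X))"
    unfolding nat using left.target.comp_assoc[OF Fu cP[OF P(2)] w] .
  also have "\<dots> = w"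
    using triangle_left[OF X] left.target.comp_id_right[OF w] by simp
  finally show ?thesis .
qed

text \<open>Under the adjunction, composing with \<open>q\<close> on maps out of \<open>ob F X\<close> is composing with the
  invertible \<open>ar G q\<close> on maps out of \<open>X\<close>.\<close>

lemma postcomp_bij_if_right_adjoint_iso:
  assumes X: "X \<in> Ob A" and q: "q \<in> hom B P Q" and iso: "is_iso A (ar G q)"
  shows "bij_betw (\<lambda>w. q \<cdot>\<^bsub>B\<^esub> w) (hom B (ob F X) P) (hom B (ob F X) Q)"
proof -
  have u: "u X \<in> hom A X (ob G (ob F X))"
    using unit.component[OF X] by (simp add: id_functor_def comp_functor_def)
  have Gq: "ar G q \<in> hom A (ob G P) (ob G Q)" using right.map_hom q by blast
  obtain p where p: "p \<in> hom A (ob G Q) (ob G P)"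
      "p \<cdot>\<^bsub>A\<^esub> ar G q = \<one>\<^bsub>A\<^esub> (ob G P)" "ar G q \<cdot>\<^bsub>A\<^esub> p = \<one>\<^bsub>A\<^esub> (ob G Q)"
    using left.source.is_isoE[OF iso Gq] by blast
  have cP: "c R \<in> hom B (ob F (ob G R)) R" if "R \<in> Ob B" for R
    using counit.component[OF that] by (simp add: id_functor_def comp_functor_def)
  have P: "P \<in> Ob B" using left.target.homD[OF q] by auto
  have adjunct: "ar G w \<cdot>\<^bsub>A\<^esub> u X \<in> hom A X (ob G R)" if "w \<in> hom B (ob F X) R" for w R
    using left.source.comp_hom[OF u right.map_hom[OF that]] .
  have natural: "ar G (q \<cdot>\<^bsub>B\<^esub> w) \<cdot>\<^bsub>A\<^esub> u X = ar G q \<cdot>\<^bsub>A\<^esub> (ar G w \<cdot>\<^bsub>A\<^esub> u X)"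
    if "w \<in> hom B (ob F X) P" for w
    using right.map_comp[OF that q] left.source.comp_assoc[OF u right.map_hom[OF that] Gq] by simp
  have recover: "c P \<cdot>\<^bsub>B\<^esub> ar F (p \<cdot>\<^bsub>A\<^esub> (ar G (q \<cdot>\<^bsub>B\<^esub> w) \<cdot>\<^bsub>A\<^esub> u X)) = w"
    if w: "w \<in> hom B (ob F X) P" for w
    using natural[OF w] left.source.cancel_left_inverse[OF Gq p(1,2) adjunct[OF w]]
      left_adjunct_inverse[OF X w] by simp
  have "\<exists>w \<in> hom B (ob F X) P. q \<cdot>\<^bsub>B\<^esub> w = h" if h: "h \<in> hom B (ob F X) Q" for h
  proof -
    let ?g = "p \<cdot>\<^bsub>A\<^esub> (ar G h \<cdot>\<^bsub>A\<^esub> u X)"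
    have g: "?g \<in> hom A X (ob G P)" using left.source.comp_hom[OF adjunct[OF h] p(1)] .
    have w: "c P \<cdot>\<^bsub>B\<^esub> ar F ?g \<in> hom B (ob F X) P"
      using left.target.comp_hom[OF left.map_hom[OF g] cP[OF P]] .
    have nat: "c Q \<cdot>\<^bsub>B\<^esub> ar F (ar G q) = q \<cdot>\<^bsub>B\<^esub> c P"
      using counit.naturality[OF q] by (simp add: id_functor_def comp_functor_def)
    have "q \<cdot>\<^bsub>B\<^esub> (c P \<cdot>\<^bsub>B\<^esub> ar F ?g) = (c Q \<cdot>\<^bsub>B\<^esub> ar F (ar G q)) \<cdot>\<^bsub>B\<^esub> ar F ?g"
      unfolding nat using left.target.comp_assoc[OF left.map_hom[OF g] cP[OF P] q] by simp
    also have "\<dots> = c Q \<cdot>\<^bsub>B\<^esub> ar F (ar G q \<cdot>\<^bsub>A\<^esub> ?g)"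
      using left.target.comp_assoc[OF left.map_hom[OF g] left.map_hom[OF Gq] cP]
        left.map_comp[OF g Gq] left.target.homD[OF q] by simp
    also have "\<dots> = c Q \<cdot>\<^bsub>B\<^esub> ar F (ar G h \<cdot>\<^bsub>A\<^esub> u X)"
      using left.source.cancel_left_inverse[OF p(1) Gq p(3) adjunct[OF h]] by simp
    also have "\<dots> = h" using left_adjunct_inverse[OF X h] .
    finally show ?thesis using w by blast
  qed
  then show ?thesis
    unfolding bij_betw_def using recover left.target.comp_hom[OF _ q]
    by (auto simp: image_iff intro!: inj_on_inverseI
        [where g = "\<lambda>h. c P \<cdot>\<^bsub>B\<^esub> ar F (p \<cdot>\<^bsub>A\<^esub> (ar G h \<cdot>\<^bsub>A\<^esub> u X))"])
qed

end

section \<open>Whiskering in a monoidal category\<close>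

context symmetric_monoidal_category
begin

lemma whisker_exchange:
  assumes "f \<in> hom C X X'" "g \<in> hom C Y Y'"
  shows "(\<one> X' \<boxtimes> g) \<cdot> (f \<boxtimes> \<one> Y) = f \<boxtimes> g" "(f \<boxtimes> \<one> Y') \<cdot> (\<one> X \<boxtimes> g) = f \<boxtimes> g"
  using tens_comp[OF assms(1) id_hom id_hom assms(2)]
    tens_comp[OF id_hom assms(1) assms(2) id_hom] homD[OF assms(1)] homD[OF assms(2)]
    comp_id_left comp_id_right assms by auto

lemma whisker_left_hom:
  "W \<in> Ob C \<Longrightarrow> f \<in> hom C X Y \<Longrightarrow> \<one> W \<boxtimes> f \<in> hom C (W \<otimes> X) (W \<otimes> Y)"
  using tens_hom id_hom by blast

lemma whisker_right_hom:
  "W \<in> Ob C \<Longrightarrow> f \<in> hom C X Y \<Longrightarrow> f \<boxtimes> \<one> W \<in> hom C (X \<otimes> W) (Y \<otimes> W)"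
  using tens_hom id_hom by blast

lemma whisker_left_comp:
  assumes "W \<in> Ob C" "f \<in> hom C X Y" "g \<in> hom C Y Z"
  shows "(\<one> W \<boxtimes> g) \<cdot> (\<one> W \<boxtimes> f) = \<one> W \<boxtimes> (g \<cdot> f)"
  using tens_comp[OF id_hom id_hom assms(2,3)] assms(1) comp_id_left id_hom by metis

lemma whisker_right_comp:
  assumes "W \<in> Ob C" "f \<in> hom C X Y" "g \<in> hom C Y Z"
  shows "(g \<boxtimes> \<one> W) \<cdot> (f \<boxtimes> \<one> W) = (g \<cdot> f) \<boxtimes> \<one> W"
  using tens_comp[OF assms(2,3) id_hom id_hom] assms(1) comp_id_left id_hom by metis

lemma tens_iso:
  assumes f: "f \<in> hom C X X'" "is_iso C f" and g: "g \<in> hom C Y Y'" "is_iso C g"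
  shows "is_iso C (f \<boxtimes> g)"
proof -
  obtain f' where f': "f' \<in> hom C X' X" "f' \<cdot> f = \<one> X" "f \<cdot> f' = \<one> X'"
    using is_isoE f by blast
  obtain g' where g': "g' \<in> hom C Y' Y" "g' \<cdot> g = \<one> Y" "g \<cdot> g' = \<one> Y'"
    using is_isoE g by blast
  have "(f' \<boxtimes> g') \<cdot> (f \<boxtimes> g) = \<one> (X \<otimes> Y)" "(f \<boxtimes> g) \<cdot> (f' \<boxtimes> g') = \<one> (X' \<otimes> Y')"
    using tens_comp[OF f(1) f'(1) g(1) g'(1)] tens_comp[OF f'(1) f(1) g'(1) g(1)]
      f' g' tens_id homD[OF f(1)] homD[OF g(1)] by simp_all
  then show ?thesis
    using is_isoI tens_hom f(1) g(1) f'(1) g'(1) by blast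
qed

text \<open>By the exchange law, \<open>a \<boxtimes> \<one> X\<close> and \<open>a \<boxtimes> \<one> Y\<close> form an isomorphism between the two whiskered
  morphisms.\<close>

lemma orthogonal_whisker_transfer:
  assumes orth: "orthogonal C (\<one> W' \<boxtimes> f) Z" and f: "f \<in> hom C X Y"
    and a: "a \<in> hom C W W'" "is_iso C a"
  shows "orthogonal C (\<one> W \<boxtimes> f) Z"
proof (rule orthogonal_iso_transfer[OF orth])
  have W: "W \<in> Ob C" "W' \<in> Ob C" and X: "X \<in> Ob C" "Y \<in> Ob C"
    using homD[OF a(1)] homD[OF f] by auto
  show "\<one> W \<boxtimes> f \<in> hom C (W \<otimes> X) (W \<otimes> Y)" "\<one> W' \<boxtimes> f \<in> hom C (W' \<otimes> X) (W' \<otimes> Y)"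
    using whisker_left_hom W f by auto
  show "a \<boxtimes> \<one> X \<in> hom C (W \<otimes> X) (W' \<otimes> X)" "a \<boxtimes> \<one> Y \<in> hom C (W \<otimes> Y) (W' \<otimes> Y)"
    using whisker_right_hom X a(1) by auto
  show "is_iso C (a \<boxtimes> \<one> X)" "is_iso C (a \<boxtimes> \<one> Y)"
    using tens_iso[OF a id_hom id_iso] X by auto
  show "(\<one> W' \<boxtimes> f) \<cdot> (a \<boxtimes> \<one> X) = (a \<boxtimes> \<one> Y) \<cdot> (\<one> W \<boxtimes> f)"
    using whisker_exchange[OF a(1) f] by simp
qed

lemma whisker_unit_cancel:
  assumes f: "f \<in> hom C X Y" and g: "g \<in> hom C X Y"
    and eq: "f \<boxtimes> \<one> (Unit C) = g \<boxtimes> \<one> (Unit C)"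
  shows "f = g"
proof -
  have X: "X \<in> Ob C" using homD[OF f] by auto
  obtain s where s: "s \<in> hom C X (X \<otimes> Unit C)" "RUnit C X \<cdot> s = \<one> X"
    using is_isoE[OF runit_iso[OF X] runit_hom[OF X]] by blast
  have "f \<cdot> RUnit C X = g \<cdot> RUnit C X"
    using runit_nat[OF f] runit_nat[OF g] eq by simp
  then show ?thesis
    using cancel_right_inverse[OF s(1) runit_hom[OF X] s(2)] f g by metis
qed

text \<open>After tensoring with \<open>Unit C\<close>, which is faithful, and composing with the invertible associator,
  both sides agree by the pentagon with two unit arguments and two uses of the triangle.\<close>

lemma runit_tensor:
  assumes X: "X \<in> Ob C" and Y: "Y \<in> Ob C"
  shows "(\<one> X \<boxtimes> RUnit C Y) \<cdot> Assoc C X Y (Unit C) = RUnit C (X \<otimes> Y)"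
proof -
  let ?I = "Unit C"
  have I: "?I \<in> Ob C" by (rule unit_ob)
  note obs = X Y I tens_ob
  let ?a = "Assoc C X Y ?I"
  have a: "?a \<in> hom C ((X \<otimes> Y) \<otimes> ?I) (X \<otimes> (Y \<otimes> ?I))" using assoc_hom obs by blast
  have r: "\<one> X \<boxtimes> RUnit C Y \<in> hom C (X \<otimes> (Y \<otimes> ?I)) (X \<otimes> Y)"
    using whisker_left_hom runit_hom obs by blast
  have ra: "(\<one> X \<boxtimes> RUnit C Y) \<cdot> ?a \<in> hom C ((X \<otimes> Y) \<otimes> ?I) (X \<otimes> Y)"
    using comp_hom[OF a r] .
  have l: "\<one> Y \<boxtimes> LUnit C ?I \<in> hom C (Y \<otimes> (?I \<otimes> ?I)) (Y \<otimes> ?I)"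
    using whisker_left_hom lunit_hom obs by blast
  have ll: "\<one> X \<boxtimes> (\<one> Y \<boxtimes> LUnit C ?I) \<in> hom C (X \<otimes> (Y \<otimes> (?I \<otimes> ?I))) (X \<otimes> (Y \<otimes> ?I))"
    using whisker_left_hom l obs by blast
  have a1: "Assoc C X Y (?I \<otimes> ?I) \<in> hom C ((X \<otimes> Y) \<otimes> (?I \<otimes> ?I)) (X \<otimes> (Y \<otimes> (?I \<otimes> ?I)))"
    using assoc_hom obs by blast
  have a2: "Assoc C (X \<otimes> Y) ?I ?I \<in> hom C (((X \<otimes> Y) \<otimes> ?I) \<otimes> ?I) ((X \<otimes> Y) \<otimes> (?I \<otimes> ?I))"
    using assoc_hom obs by blast
  have a3: "Assoc C Y ?I ?I \<in> hom C ((Y \<otimes> ?I) \<otimes> ?I) (Y \<otimes> (?I \<otimes> ?I))"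
    using assoc_hom obs by blast
  have a3': "\<one> X \<boxtimes> Assoc C Y ?I ?I \<in> hom C (X \<otimes> ((Y \<otimes> ?I) \<otimes> ?I)) (X \<otimes> (Y \<otimes> (?I \<otimes> ?I)))"
    using whisker_left_hom a3 obs by blast
  have a4: "Assoc C X (Y \<otimes> ?I) ?I \<in> hom C ((X \<otimes> (Y \<otimes> ?I)) \<otimes> ?I) (X \<otimes> ((Y \<otimes> ?I) \<otimes> ?I))"
    using assoc_hom obs by blast
  have a5: "?a \<boxtimes> \<one> ?I \<in> hom C (((X \<otimes> Y) \<otimes> ?I) \<otimes> ?I) ((X \<otimes> (Y \<otimes> ?I)) \<otimes> ?I)"
    using whisker_right_hom a obs by blast
  have xyl: "\<one> (X \<otimes> Y) \<boxtimes> LUnit C ?I \<in> hom C ((X \<otimes> Y) \<otimes> (?I \<otimes> ?I)) ((X \<otimes> Y) \<otimes> ?I)"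
    using whisker_left_hom lunit_hom obs by blast
  have ri: "(\<one> X \<boxtimes> RUnit C Y) \<boxtimes> \<one> ?I \<in> hom C ((X \<otimes> (Y \<otimes> ?I)) \<otimes> ?I) ((X \<otimes> Y) \<otimes> ?I)"
    using whisker_right_hom r obs by blast
  let ?ll = "\<one> X \<boxtimes> (\<one> Y \<boxtimes> LUnit C ?I)" and ?ri = "(\<one> X \<boxtimes> RUnit C Y) \<boxtimes> \<one> ?I"
  have ll_a3: "?ll \<cdot> (\<one> X \<boxtimes> Assoc C Y ?I ?I) = \<one> X \<boxtimes> (RUnit C Y \<boxtimes> \<one> ?I)"
    using whisker_left_comp[OF X a3 l] triangle[OF Y I] by simp
  have slide_l: "?a \<cdot> (\<one> (X \<otimes> Y) \<boxtimes> LUnit C ?I) = ?ll \<cdot> Assoc C X Y (?I \<otimes> ?I)"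
    using assoc_nat[OF id_hom[OF X] id_hom[OF Y] lunit_hom[OF I]] tens_id[OF X Y] by simp
  have slide_r: "(\<one> X \<boxtimes> (RUnit C Y \<boxtimes> \<one> ?I)) \<cdot> Assoc C X (Y \<otimes> ?I) ?I = ?a \<cdot> ?ri"
    using assoc_nat[OF id_hom[OF X] runit_hom[OF Y] id_hom[OF I]] by simp
  have "?a \<cdot> (RUnit C (X \<otimes> Y) \<boxtimes> \<one> ?I)
      = (?a \<cdot> (\<one> (X \<otimes> Y) \<boxtimes> LUnit C ?I)) \<cdot> Assoc C (X \<otimes> Y) ?I ?I"
    using triangle[OF obs(4)[OF X Y] I] comp_assoc[OF a2 xyl a] by simp
  also have "\<dots> = ?ll \<cdot> Assoc C X Y (?I \<otimes> ?I) \<cdot> Assoc C (X \<otimes> Y) ?I ?I"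
    unfolding slide_l by (rule comp_assoc[OF a2 a1 ll])
  also have "\<dots> = ?ll \<cdot> (\<one> X \<boxtimes> Assoc C Y ?I ?I) \<cdot> Assoc C X (Y \<otimes> ?I) ?I \<cdot> (?a \<boxtimes> \<one> ?I)"
    unfolding pentagon[OF X Y I I] ..
  also have "\<dots> = (\<one> X \<boxtimes> (RUnit C Y \<boxtimes> \<one> ?I)) \<cdot> Assoc C X (Y \<otimes> ?I) ?I \<cdot> (?a \<boxtimes> \<one> ?I)"
    using comp_assoc[OF comp_hom[OF a5 a4] a3' ll] unfolding ll_a3 by simp
  also have "\<dots> = ?a \<cdot> ?ri \<cdot> (?a \<boxtimes> \<one> ?I)"
    using comp_assoc[OF a5 a4 comp_hom[OF a3' ll]] comp_assoc[OF a5 ri a]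
    unfolding ll_a3 slide_r by simp
  also have "\<dots> = ?a \<cdot> (((\<one> X \<boxtimes> RUnit C Y) \<cdot> ?a) \<boxtimes> \<one> ?I)"
    using whisker_right_comp[OF I a r] by simp
  finally have eq: "?a \<cdot> (RUnit C (X \<otimes> Y) \<boxtimes> \<one> ?I) = ?a \<cdot> (((\<one> X \<boxtimes> RUnit C Y) \<cdot> ?a) \<boxtimes> \<one> ?I)" .
  obtain b where b: "b \<in> hom C (X \<otimes> (Y \<otimes> ?I)) ((X \<otimes> Y) \<otimes> ?I)" "b \<cdot> ?a = \<one> ((X \<otimes> Y) \<otimes> ?I)"
    using is_isoE[OF assoc_iso a] X Y I by blast
  have rho: "RUnit C (X \<otimes> Y) \<in> hom C ((X \<otimes> Y) \<otimes> ?I) (X \<otimes> Y)"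
    using runit_hom obs by blast
  have "RUnit C (X \<otimes> Y) \<boxtimes> \<one> ?I = ((\<one> X \<boxtimes> RUnit C Y) \<cdot> ?a) \<boxtimes> \<one> ?I"
    using eq cancel_left_inverse[OF a b] whisker_right_hom[OF I rho] whisker_right_hom[OF I ra]
    by metis
  then show ?thesis
    using whisker_unit_cancel[OF rho ra] by simp
qed

end


section \<open>Internal homs\<close>

context closed_symmetric_monoidal_category
begin

lemma transpose:
  assumes "A \<in> Ob C" "X \<in> Ob C" "f \<in> hom C (A \<otimes> X) Y"
  shows "transpose C A X Y f \<in> hom C A (IHom C X Y)"
    and "Ev C X Y \<cdot> (transpose C A X Y f \<boxtimes> \<one> X) = f"
  using theI'[OF ev_universal[OF assms(1,2) homD(5)[OF assms(3)] assms(3)]]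
  unfolding transpose_def by blast+

lemma ev_cancel:
  assumes X: "X \<in> Ob C" and Y: "Y \<in> Ob C"
    and g: "g \<in> hom C A (IHom C X Y)" and h: "h \<in> hom C A (IHom C X Y)"
    and eq: "Ev C X Y \<cdot> (g \<boxtimes> \<one> X) = Ev C X Y \<cdot> (h \<boxtimes> \<one> X)"
  shows "g = h"
proof -
  have A: "A \<in> Ob C" using homD[OF g] by auto
  have "Ev C X Y \<cdot> (g \<boxtimes> \<one> X) \<in> hom C (A \<otimes> X) Y"
    using comp_hom[OF whisker_right_hom[OF X g] ev_hom[OF X Y]] .
  from ev_universal[OF A X Y this] show ?thesis using g h eq by metis
qed

lemma ihom_pre:
  assumes f: "f \<in> hom C X Y" and Z: "Z \<in> Ob C"
  shows "ihom_pre C f Z \<in> hom C (IHom C Y Z) (IHom C X Z)"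
    and "Ev C X Z \<cdot> (ihom_pre C f Z \<boxtimes> \<one> X) = Ev C Y Z \<cdot> (\<one> (IHom C Y Z) \<boxtimes> f)"
proof -
  have obs: "X \<in> Ob C" "Y \<in> Ob C" "IHom C Y Z \<in> Ob C"
    using homD[OF f] ihom_ob Z by auto
  have "Ev C Y Z \<cdot> (\<one> (IHom C Y Z) \<boxtimes> f) \<in> hom C (IHom C Y Z \<otimes> X) Z"
    using comp_hom[OF whisker_left_hom[OF obs(3) f] ev_hom[OF obs(2) Z]] .
  from transpose[OF obs(3,1) this] homD[OF f]
  show "ihom_pre C f Z \<in> hom C (IHom C Y Z) (IHom C X Z)"
    "Ev C X Z \<cdot> (ihom_pre C f Z \<boxtimes> \<one> X) = Ev C Y Z \<cdot> (\<one> (IHom C Y Z) \<boxtimes> f)"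
    unfolding ihom_pre_def by simp_all
qed

text \<open>Currying turns restriction along \<open>\<one> A \<boxtimes> f\<close> into composition with \<open>ihom_pre C f Z\<close>.\<close>

lemma ihom_pre_untranspose:
  assumes f: "f \<in> hom C X Y" and Z: "Z \<in> Ob C" and w: "w \<in> hom C A (IHom C Y Z)"
  shows "(Ev C Y Z \<cdot> (w \<boxtimes> \<one> Y)) \<cdot> (\<one> A \<boxtimes> f) = Ev C X Z \<cdot> ((ihom_pre C f Z \<cdot> w) \<boxtimes> \<one> X)"
proof -
  have obs: "X \<in> Ob C" "Y \<in> Ob C" "A \<in> Ob C" "IHom C Y Z \<in> Ob C"
    using homD[OF f] homD[OF w] by auto
  note q = ihom_pre[OF f Z]
  note hs = whisker_right_hom[OF obs(1) w] whisker_right_hom[OF obs(2) w]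
    whisker_left_hom[OF obs(3) f] whisker_left_hom[OF obs(4) f] ev_hom[OF obs(2) Z]
    whisker_right_hom[OF obs(1) q(1)] ev_hom[OF obs(1) Z]
  have "(Ev C Y Z \<cdot> (w \<boxtimes> \<one> Y)) \<cdot> (\<one> A \<boxtimes> f)
      = Ev C Y Z \<cdot> ((\<one> (IHom C Y Z) \<boxtimes> f) \<cdot> (w \<boxtimes> \<one> X))"
    using comp_assoc[OF hs(3,2,5)] whisker_exchange[OF w f] by simp
  also have "\<dots> = Ev C X Z \<cdot> ((ihom_pre C f Z \<boxtimes> \<one> X) \<cdot> (w \<boxtimes> \<one> X))"
    using comp_assoc[OF hs(1,4,5)] comp_assoc[OF hs(1,6,7)] q(2) by simp
  also have "\<dots> = Ev C X Z \<cdot> ((ihom_pre C f Z \<cdot> w) \<boxtimes> \<one> X)"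
    using whisker_right_comp[OF obs(1) w q(1)] by simp
  finally show ?thesis .
qed

lemma orthogonal_if_ihom_pre_bij:
  assumes A: "A \<in> Ob C" and f: "f \<in> hom C X Y" and Z: "Z \<in> Ob C"
    and bij: "bij_betw (\<lambda>w. ihom_pre C f Z \<cdot> w) (hom C A (IHom C Y Z)) (hom C A (IHom C X Z))"
  shows "orthogonal C (\<one> A \<boxtimes> f) Z"
proof (rule orthogonalI[OF whisker_left_hom[OF A f]])
  have X: "X \<in> Ob C" and Y: "Y \<in> Ob C" using homD[OF f] by auto
  note q = ihom_pre(1)[OF f Z]
  { fix h k assume h: "h \<in> hom C (A \<otimes> Y) Z" and k: "k \<in> hom C (A \<otimes> Y) Z"
      and eq: "h \<cdot> (\<one> A \<boxtimes> f) = k \<cdot> (\<one> A \<boxtimes> f)"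
    note h' = transpose[OF A Y h] and k' = transpose[OF A Y k]
    have "ihom_pre C f Z \<cdot> transpose C A Y Z h = ihom_pre C f Z \<cdot> transpose C A Y Z k"
      using ev_cancel[OF X Z comp_hom[OF h'(1) q] comp_hom[OF k'(1) q]]
        ihom_pre_untranspose[OF f Z h'(1)] ihom_pre_untranspose[OF f Z k'(1)] h'(2) k'(2) eq
      by simp
    then have "transpose C A Y Z h = transpose C A Y Z k"
      using bij h'(1) k'(1) unfolding bij_betw_def inj_on_def by blast
    then show "h = k" using h'(2) k'(2) by metis
  next
    fix h assume h: "h \<in> hom C (A \<otimes> X) Z"
    note h' = transpose[OF A X h]
    obtain w where w: "w \<in> hom C A (IHom C Y Z)" "ihom_pre C f Z \<cdot> w = transpose C A X Z h"
      using bij h'(1) unfolding bij_betw_def by (metis (no_types, lifting) imageE)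
    then have "(Ev C Y Z \<cdot> (w \<boxtimes> \<one> Y)) \<cdot> (\<one> A \<boxtimes> f) = h"
      using ihom_pre_untranspose[OF f Z w(1)] h'(2) by simp
    then show "\<exists>k \<in> hom C (A \<otimes> Y) Z. k \<cdot> (\<one> A \<boxtimes> f) = h"
      using comp_hom[OF whisker_right_hom[OF Y w(1)] ev_hom[OF Y Z]] by blast
  }
qed

end

text \<open>This translates the hypothesis on objects of \<open>V\<close> into a statement about morphisms of \<open>E\<close>: currying
  reduces the claim to composition with \<open>ihom_pre E f Z\<close> on maps out of \<open>ob i A\<close>, and the adjunction
  reduces that to the invertible \<open>pullback E r f Z\<close>.\<close>

lemma (in closed_symmetric_monoidal_V_category) orthogonal_if_pullback_iso:
  assumes A: "A \<in> Ob V" and f: "f \<in> hom E X Y" and Z: "Z \<in> Ob E"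
    and iso: "is_iso V (pullback E r f Z)"
  shows "orthogonal E (\<one>\<^bsub>E\<^esub> (ob i A) \<boxtimes>\<^bsub>E\<^esub> f) Z"
  using orthogonal_if_ihom_pre_bij[OF left.map_ob[OF A] f Z]
    postcomp_bij_if_right_adjoint_iso[OF A ihom_pre(1)[OF f Z]] iso
  unfolding pullback_def by blast

section \<open>Monoid structures with a prescribed unit\<close>

context symmetric_monoidal_category
begin

lemma monoidD:
  assumes "is_monoid C R"
  shows "Carrier R \<in> Ob C" "Mult R \<in> hom C (Carrier R \<otimes> Carrier R) (Carrier R)"
    "Eta R \<in> hom C (Unit C) (Carrier R)"
    "Mult R \<cdot> (Mult R \<boxtimes> \<one> (Carrier R))
       = Mult R \<cdot> (\<one> (Carrier R) \<boxtimes> Mult R) \<cdot> Assoc C (Carrier R) (Carrier R) (Carrier R)"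
    "Mult R \<cdot> (Eta R \<boxtimes> \<one> (Carrier R)) = LUnit C (Carrier R)"
    "Mult R \<cdot> (\<one> (Carrier R) \<boxtimes> Eta R) = RUnit C (Carrier R)"
  using assms unfolding is_monoid_def by auto

text \<open>Compatibility with the multiplications follows from the left unit law, so prescribing that a
  morphism from the unit is a morphism of monoids only prescribes the unit of the target.\<close>

lemma monoid_unit_is_morphism:
  assumes R: "is_monoid C R"
  shows "monoid_morphism C (unit_monoid C) R (Eta R)"
proof -
  let ?I = "Unit C" and ?P = "Carrier R" and ?e = "Eta R"
  note m = monoidD[OF R]
  have "Mult R \<cdot> (?e \<boxtimes> ?e) = Mult R \<cdot> (?e \<boxtimes> \<one> ?P) \<cdot> (\<one> ?I \<boxtimes> ?e)"
    using whisker_exchange(2)[OF m(3) m(3)] by simp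
  also have "\<dots> = LUnit C ?P \<cdot> (\<one> ?I \<boxtimes> ?e)"
    using comp_assoc[OF whisker_left_hom[OF unit_ob m(3)] whisker_right_hom[OF m(1,3)] m(2)] m(5)
    by simp
  also have "\<dots> = ?e \<cdot> LUnit C ?I" using lunit_nat[OF m(3)] .
  finally show ?thesis
    unfolding monoid_morphism_def unit_monoid_def using m(3) comp_id_right[OF m(3)] by simp
qed

lemma localized_unit_monoid_iff:
  "localized_unit_monoid C L l R \<longleftrightarrow>
     is_monoid C R \<and> Carrier R = ob L (Unit C) \<and> Eta R = l (Unit C)"
proof -
  have "Eta R = l (Unit C)" if "monoid_morphism C (unit_monoid C) R (l (Unit C))"
    using that comp_id_right unfolding monoid_morphism_def unit_monoid_def by fastforce
  then show ?thesis
    using monoid_unit_is_morphism unfolding localized_unit_monoid_def by metis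
qed

text \<open>Conjugation by \<open>\<phi>\<close> defines the multiplication on \<open>P\<close>.\<close>

lemma monoid_transport:
  assumes R: "is_monoid C R" and phi: "\<phi> \<in> hom C (Carrier R) P" and iso: "is_iso C \<phi>"
  obtains S where "is_monoid C S" "Carrier S = P" "Eta S = \<phi> \<cdot> Eta R" "monoid_morphism C R S \<phi>"
proof -
  let ?R = "Carrier R"
  note m = monoidD[OF R]
  obtain \<psi> where psi: "\<psi> \<in> hom C P ?R" "\<psi> \<cdot> \<phi> = \<one> ?R" "\<phi> \<cdot> \<psi> = \<one> P"
    using is_isoE[OF iso phi] by blast
  have P: "P \<in> Ob C" using homD[OF phi] by auto
  define \<mu> where "\<mu> = \<phi> \<cdot> Mult R \<cdot> (\<psi> \<boxtimes> \<psi>)"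
  have pp: "\<psi> \<boxtimes> \<psi> \<in> hom C (P \<otimes> P) (?R \<otimes> ?R)" using tens_hom psi(1) by blast
  have mu: "\<mu> \<in> hom C (P \<otimes> P) P"
    unfolding \<mu>_def using comp_hom[OF comp_hom[OF pp m(2)] phi] .
  have phi_m: "\<phi> \<cdot> Mult R \<in> hom C (?R \<otimes> ?R) P" using comp_hom[OF m(2) phi] .
  have mu_tens: "\<mu> \<cdot> (f \<boxtimes> g) = (\<phi> \<cdot> Mult R) \<cdot> ((\<psi> \<cdot> f) \<boxtimes> (\<psi> \<cdot> g))"
    if "f \<in> hom C X P" "g \<in> hom C Y P" for f g X Y
    unfolding \<mu>_def
    using comp_assoc[OF tens_hom[OF that] pp phi_m] comp_assoc[OF pp m(2) phi]
      tens_comp[OF that(1) psi(1) that(2) psi(1)] by simp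
  have psi_mu: "\<psi> \<cdot> \<mu> = Mult R \<cdot> (\<psi> \<boxtimes> \<psi>)"
    unfolding \<mu>_def using cancel_left_inverse[OF phi psi(1,2) comp_hom[OF pp m(2)]] .
  have psi_id: "\<psi> \<cdot> \<one> P = \<psi>" using comp_id_right psi(1) by blast
  have psi_eta: "\<psi> \<cdot> \<phi> \<cdot> Eta R = Eta R"
    using cancel_left_inverse[OF phi psi(1,2) m(3)] .
  have eta: "\<phi> \<cdot> Eta R \<in> hom C (Unit C) P" using comp_hom[OF m(3) phi] .
  have split_l: "(f \<cdot> g) \<boxtimes> \<psi> = (f \<boxtimes> \<one> ?R) \<cdot> (g \<boxtimes> \<psi>)"
    if "g \<in> hom C X Y" "f \<in> hom C Y ?R" for f g X Y
    using tens_comp[OF that psi(1) id_hom[OF m(1)]] comp_id_left[OF psi(1)] by simp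
  have split_r: "\<psi> \<boxtimes> (f \<cdot> g) = (\<one> ?R \<boxtimes> f) \<cdot> (\<psi> \<boxtimes> g)"
    if "g \<in> hom C X Y" "f \<in> hom C Y ?R" for f g X Y
    using tens_comp[OF psi(1) id_hom[OF m(1)] that] comp_id_left[OF psi(1)] by simp
  have assoc: "\<mu> \<cdot> (\<mu> \<boxtimes> \<one> P) = \<mu> \<cdot> (\<one> P \<boxtimes> \<mu>) \<cdot> Assoc C P P P"
  proof -
    let ?a = "Assoc C ?R ?R ?R" and ?b = "Assoc C P P P"
    let ?p3 = "(\<psi> \<boxtimes> \<psi>) \<boxtimes> \<psi>" and ?p3' = "\<psi> \<boxtimes> (\<psi> \<boxtimes> \<psi>)"
    have p3: "?p3 \<in> hom C ((P \<otimes> P) \<otimes> P) ((?R \<otimes> ?R) \<otimes> ?R)" using tens_hom pp psi(1) by blast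
    have p3': "?p3' \<in> hom C (P \<otimes> (P \<otimes> P)) (?R \<otimes> (?R \<otimes> ?R))" using tens_hom pp psi(1) by blast
    have a: "?a \<in> hom C ((?R \<otimes> ?R) \<otimes> ?R) (?R \<otimes> (?R \<otimes> ?R))" using assoc_hom m(1) by blast
    have b: "?b \<in> hom C ((P \<otimes> P) \<otimes> P) (P \<otimes> (P \<otimes> P))" using assoc_hom P by blast
    note ml = whisker_right_hom[OF m(1,2)] and mr = whisker_left_hom[OF m(1,2)]
    have "\<mu> \<cdot> (\<mu> \<boxtimes> \<one> P) = (\<phi> \<cdot> Mult R) \<cdot> (Mult R \<boxtimes> \<one> ?R) \<cdot> ?p3"
      using mu_tens[OF mu id_hom[OF P]] psi_mu psi_id split_l[OF pp m(2)] by simp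
    also have "\<dots> = \<phi> \<cdot> (Mult R \<cdot> (Mult R \<boxtimes> \<one> ?R)) \<cdot> ?p3"
      using comp_assoc[OF comp_hom[OF p3 ml] m(2) phi] comp_assoc[OF p3 ml m(2)] by simp
    also have "\<dots> = \<phi> \<cdot> (Mult R \<cdot> (\<one> ?R \<boxtimes> Mult R) \<cdot> ?a) \<cdot> ?p3"
      using m(4) by simp
    also have "\<dots> = \<phi> \<cdot> Mult R \<cdot> (\<one> ?R \<boxtimes> Mult R) \<cdot> ?a \<cdot> ?p3"
      using comp_assoc[OF p3 comp_hom[OF a mr] m(2)] comp_assoc[OF p3 a mr] by simp
    also have "\<dots> = \<phi> \<cdot> Mult R \<cdot> (\<one> ?R \<boxtimes> Mult R) \<cdot> ?p3' \<cdot> ?b"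
      using assoc_nat[OF psi(1) psi(1) psi(1)] by simp
    also have "\<dots> = ((\<phi> \<cdot> Mult R) \<cdot> ((\<one> ?R \<boxtimes> Mult R) \<cdot> ?p3')) \<cdot> ?b"
      using comp_assoc[OF b p3' mr] comp_assoc[OF b comp_hom[OF p3' mr] phi_m]
        comp_assoc[OF comp_hom[OF b comp_hom[OF p3' mr]] m(2) phi] by simp
    also have "(\<phi> \<cdot> Mult R) \<cdot> ((\<one> ?R \<boxtimes> Mult R) \<cdot> ?p3') = \<mu> \<cdot> (\<one> P \<boxtimes> \<mu>)"
      using mu_tens[OF id_hom[OF P] mu] psi_mu psi_id split_r[OF pp m(2)] by simp
    also have "(\<mu> \<cdot> (\<one> P \<boxtimes> \<mu>)) \<cdot> ?b = \<mu> \<cdot> (\<one> P \<boxtimes> \<mu>) \<cdot> ?b"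
      using comp_assoc[OF b whisker_left_hom[OF P mu] mu] .
    finally show ?thesis .
  qed
  have psi_I: "\<one> (Unit C) \<boxtimes> \<psi> \<in> hom C (Unit C \<otimes> P) (Unit C \<otimes> ?R)"
      "\<psi> \<boxtimes> \<one> (Unit C) \<in> hom C (P \<otimes> Unit C) (?R \<otimes> Unit C)"
    using whisker_left_hom whisker_right_hom unit_ob psi(1) by blast+
  have lunit: "\<mu> \<cdot> ((\<phi> \<cdot> Eta R) \<boxtimes> \<one> P) = LUnit C P"
  proof -
    have "\<mu> \<cdot> ((\<phi> \<cdot> Eta R) \<boxtimes> \<one> P) = (\<phi> \<cdot> Mult R) \<cdot> (Eta R \<boxtimes> \<one> ?R) \<cdot> (\<one> (Unit C) \<boxtimes> \<psi>)"
      using mu_tens[OF eta id_hom[OF P]] psi_eta psi_id whisker_exchange(2)[OF m(3) psi(1)] by simp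
    also have "\<dots> = \<phi> \<cdot> LUnit C ?R \<cdot> (\<one> (Unit C) \<boxtimes> \<psi>)"
      using comp_assoc[OF comp_hom[OF psi_I(1) whisker_right_hom[OF m(1,3)]] m(2) phi]
        comp_assoc[OF psi_I(1) whisker_right_hom[OF m(1,3)] m(2)] m(5) by simp
    also have "\<dots> = LUnit C P"
      using lunit_nat[OF psi(1)] cancel_left_inverse[OF psi(1) phi psi(3) lunit_hom[OF P]] by simp
    finally show ?thesis .
  qed
  have runit: "\<mu> \<cdot> (\<one> P \<boxtimes> (\<phi> \<cdot> Eta R)) = RUnit C P"
  proof -
    have "\<mu> \<cdot> (\<one> P \<boxtimes> (\<phi> \<cdot> Eta R)) = (\<phi> \<cdot> Mult R) \<cdot> (\<one> ?R \<boxtimes> Eta R) \<cdot> (\<psi> \<boxtimes> \<one> (Unit C))"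
      using mu_tens[OF id_hom[OF P] eta] psi_eta psi_id whisker_exchange(1)[OF psi(1) m(3)] by simp
    also have "\<dots> = \<phi> \<cdot> RUnit C ?R \<cdot> (\<psi> \<boxtimes> \<one> (Unit C))"
      using comp_assoc[OF comp_hom[OF psi_I(2) whisker_left_hom[OF m(1,3)]] m(2) phi]
        comp_assoc[OF psi_I(2) whisker_left_hom[OF m(1,3)] m(2)] m(6) by simp
    also have "\<dots> = RUnit C P"
      using runit_nat[OF psi(1)] cancel_left_inverse[OF psi(1) phi psi(3) runit_hom[OF P]] by simp
    finally show ?thesis .
  qed
  let ?S = "\<lparr>Carrier = P, Mult = \<mu>, Eta = \<phi> \<cdot> Eta R\<rparr>"
  have "is_monoid C ?S"
    unfolding is_monoid_def using P mu eta assoc lunit runit by simp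
  moreover have "\<mu> \<cdot> (\<phi> \<boxtimes> \<phi>) = \<phi> \<cdot> Mult R"
    using mu_tens[OF phi phi] psi(2) tens_id[OF m(1,1)] comp_id_right[OF phi_m] by simp
  then have "monoid_morphism C R ?S \<phi>"
    unfolding monoid_morphism_def using phi by simp
  ultimately show ?thesis using that[of ?S] by simp
qed

text \<open>The multiplication is the unique extension of the right unitor along \<open>\<one> P \<boxtimes> e\<close>; every other
  axiom is an equation of morphisms into \<open>P\<close> that can be tested after restriction along some
  \<open>\<one> W \<boxtimes> e\<close>.\<close>

lemma unique_monoid_if_orthogonal:
  assumes e: "e \<in> hom C (Unit C) P"
    and orth_I: "orthogonal C (\<one> (Unit C) \<boxtimes> e) P"
    and orth_P: "orthogonal C (\<one> P \<boxtimes> e) P"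
    and orth_PP: "orthogonal C (\<one> (P \<otimes> P) \<boxtimes> e) P"
  shows "\<exists>!R. is_monoid C R \<and> Carrier R = P \<and> Eta R = e"
proof -
  let ?I = "Unit C" and ?a = "Assoc C P P P"
  have I: "?I \<in> Ob C" and P: "P \<in> Ob C" and PP: "P \<otimes> P \<in> Ob C"
    using unit_ob homD[OF e] tens_ob by auto
  note eP = whisker_right_hom[OF P e] and Pe = whisker_left_hom[OF P e]
    and Ie = whisker_left_hom[OF I e] and PPe = whisker_left_hom[OF PP e]
  obtain \<mu> where mu: "\<mu> \<in> hom C (P \<otimes> P) P" and right: "\<mu> \<cdot> (\<one> P \<boxtimes> e) = RUnit C P"
    using orthogonal_extend[OF orth_P Pe runit_hom[OF P]] by blast
  note muP = whisker_right_hom[OF P mu] and Pmu = whisker_left_hom[OF P mu]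
  \<comment> \<open>Restricted along \<open>\<one> ?I \<boxtimes> e\<close>, the left unit law becomes the right unit law by exchange, since
    the two unitors agree on \<open>?I \<otimes> ?I\<close>.\<close>
  have "(\<mu> \<cdot> (e \<boxtimes> \<one> P)) \<cdot> (\<one> ?I \<boxtimes> e) = (\<mu> \<cdot> (\<one> P \<boxtimes> e)) \<cdot> (e \<boxtimes> \<one> ?I)"
    using comp_assoc[OF Ie eP mu] comp_assoc[OF whisker_right_hom[OF I e] Pe mu]
      whisker_exchange[OF e e] by simp
  also have "\<dots> = e \<cdot> LUnit C ?I"
    using right runit_nat[OF e] unitors_agree by simp
  also have "\<dots> = LUnit C P \<cdot> (\<one> ?I \<boxtimes> e)"
    using lunit_nat[OF e] by simp
  finally have left: "\<mu> \<cdot> (e \<boxtimes> \<one> P) = LUnit C P"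
    using orthogonal_unique[OF orth_I Ie comp_hom[OF eP mu] lunit_hom[OF P]] by blast
  have a: "?a \<in> hom C ((P \<otimes> P) \<otimes> P) (P \<otimes> (P \<otimes> P))" using assoc_hom P by blast
  have a': "Assoc C P P ?I \<in> hom C ((P \<otimes> P) \<otimes> ?I) (P \<otimes> (P \<otimes> ?I))" using assoc_hom P I by blast
  note PPe' = whisker_left_hom[OF P Pe]
  \<comment> \<open>Inserting the unit as third factor reduces both bracketings of a triple product to \<open>\<mu>\<close> on the
    first two factors.\<close>
  have "(\<mu> \<cdot> (\<mu> \<boxtimes> \<one> P)) \<cdot> (\<one> (P \<otimes> P) \<boxtimes> e) = (\<mu> \<cdot> (\<one> P \<boxtimes> e)) \<cdot> (\<mu> \<boxtimes> \<one> ?I)"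
    using comp_assoc[OF PPe muP mu] comp_assoc[OF whisker_right_hom[OF I mu] Pe mu]
      whisker_exchange[OF mu e] by simp
  also have "\<dots> = \<mu> \<cdot> RUnit C (P \<otimes> P)"
    using right runit_nat[OF mu] by simp
  also have "\<dots> = \<mu> \<cdot> (\<one> P \<boxtimes> RUnit C P) \<cdot> Assoc C P P ?I"
    using runit_tensor[OF P P] by simp
  also have "\<dots> = \<mu> \<cdot> (\<one> P \<boxtimes> \<mu>) \<cdot> (\<one> P \<boxtimes> (\<one> P \<boxtimes> e)) \<cdot> Assoc C P P ?I"
    using comp_assoc[OF a' PPe' Pmu] whisker_left_comp[OF P Pe mu] right by simp
  also have "\<dots> = \<mu> \<cdot> (\<one> P \<boxtimes> \<mu>) \<cdot> ?a \<cdot> (\<one> (P \<otimes> P) \<boxtimes> e)"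
    using assoc_nat[OF id_hom[OF P] id_hom[OF P] e] tens_id[OF P P] by simp
  also have "\<dots> = (\<mu> \<cdot> (\<one> P \<boxtimes> \<mu>) \<cdot> ?a) \<cdot> (\<one> (P \<otimes> P) \<boxtimes> e)"
    using comp_assoc[OF PPe a Pmu] comp_assoc[OF PPe comp_hom[OF a Pmu] mu] by simp
  finally have assoc: "\<mu> \<cdot> (\<mu> \<boxtimes> \<one> P) = \<mu> \<cdot> (\<one> P \<boxtimes> \<mu>) \<cdot> ?a"
    using orthogonal_unique[OF orth_PP PPe comp_hom[OF muP mu] comp_hom[OF comp_hom[OF a Pmu] mu]]
    by blast
  have "is_monoid C \<lparr>Carrier = P, Mult = \<mu>, Eta = e\<rparr>"
    unfolding is_monoid_def using P mu e assoc left right by simp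
  moreover have "R = \<lparr>Carrier = P, Mult = \<mu>, Eta = e\<rparr>"
    if "is_monoid C R \<and> Carrier R = P \<and> Eta R = e" for R
    using that monoidD(2,6)[of R] orthogonal_unique[OF orth_P Pe _ mu] right by (cases R) auto
  ultimately show ?thesis by (metis mon.select_convs(1,3))
qed

end

section \<open>Localizations of the unit\<close>

lemma localization_functorD:
  assumes "localization_functor E L l"
  shows "nat_trans E E id_functor L l"
    and "\<And>X. X \<in> Ob E \<Longrightarrow> is_iso E (l (ob L X))"
    and "\<And>X. X \<in> Ob E \<Longrightarrow> is_iso E (ar L (l X))"
  using assms unfolding localization_functor_def by metis+

lemma localization_unit_hom:
  assumes "localization_functor E L l" "X \<in> Ob E"
  shows "l X \<in> hom E X (ob L X)"
  using nat_trans.component[OF localization_functorD(1)[OF assms(1)] assms(2)]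
  by (simp add: id_functor_def)

lemma localization_unit_local_equivalence:
  assumes L: "localization_functor E L l" and X: "X \<in> Ob E"
  shows "l X \<in> local_equivalences E L"
  using localization_unit_hom[OF L X] localization_functorD(3)[OF L X]
  by (simp add: local_equivalences_def hom_def)

lemma localization_naturality:
  assumes "localization_functor E L l" "f \<in> hom E X Y"
  shows "l Y \<cdot>\<^bsub>E\<^esub> f = ar L f \<cdot>\<^bsub>E\<^esub> l X"
  using nat_trans.naturality[OF localization_functorD(1)[OF assms(1)] assms(2)]
  by (simp add: id_functor_def)

context category
begin

lemma localization_local_objectI:
  assumes "localization_functor C L l" "X \<in> Ob C"
  shows "ob L X \<in> local_objects C L"
  using assms localization_unit_hom[OF assms] homD isomorphic_refl
  unfolding local_objects_def by blast

text \<open>The condition on \<open>l (ob L X)\<close> spreads along an isomorphism \<open>Z \<cong> ob L X\<close> by naturality of \<open>l\<close>.\<close>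

lemma localization_unit_iso_if_local:
  assumes L: "localization_functor C L l" and Z: "Z \<in> local_objects C L"
  shows "is_iso C (l Z)"
proof -
  interpret L: cat_functor C C L
    using localization_functorD(1)[OF L] by (simp add: nat_trans_def)
  obtain X where X: "X \<in> Ob C" "isomorphic C Z (ob L X)" and Z': "Z \<in> Ob C"
    using Z unfolding local_objects_def by blast
  obtain f g where f: "f \<in> hom C Z (ob L X)" and g: "g \<in> hom C (ob L X) Z"
      and fg: "g \<cdot> f = \<one> Z" "f \<cdot> g = \<one> (ob L X)"
    using isomorphicE[OF X(2)] by blast
  note LX = L.map_ob[OF X(1)]
  have "l Z \<cdot> g = ar L g \<cdot> l (ob L X)"
    using localization_naturality[OF L g] .
  then have "l Z = (ar L g \<cdot> l (ob L X)) \<cdot> f"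
    using cancel_right_inverse[OF f g fg(1) localization_unit_hom[OF L Z']] by simp
  moreover have "is_iso C (ar L g)" "is_iso C f"
    using L.map_iso[OF is_isoI[OF g f fg(2,1)] g] is_isoI[OF f g fg] by auto
  ultimately show ?thesis
    using iso_comp[OF f _ comp_hom[OF localization_unit_hom[OF L LX] L.map_hom[OF g]]]
      iso_comp[OF localization_unit_hom[OF L LX] localization_functorD(2)[OF L X(1)] L.map_hom[OF g]]
    by simp
qed

text \<open>A local equivalence into a local object is a localization of its domain: \<open>\<phi>\<close> is the
  composite of \<open>l Y\<close>, invertible because \<open>Y\<close> is local, with the inverse of \<open>ar L f\<close>.\<close>

lemma local_equivalence_to_local_object:
  assumes L: "localization_functor C L l" and f: "f \<in> hom C X Y"
    and equiv: "f \<in> local_equivalences C L" and Y: "Y \<in> local_objects C L"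
  obtains \<phi> where "\<phi> \<in> hom C Y (ob L X)" "is_iso C \<phi>" "\<phi> \<cdot> f = l X"
proof -
  interpret L: cat_functor C C L
    using localization_functorD(1)[OF L] by (simp add: nat_trans_def)
  have obs: "X \<in> Ob C" "Y \<in> Ob C" using homD[OF f] by auto
  have Lf: "ar L f \<in> hom C (ob L X) (ob L Y)" "is_iso C (ar L f)"
    using L.map_hom[OF f] equiv by (auto simp: local_equivalences_def)
  obtain g where g: "g \<in> hom C (ob L Y) (ob L X)" "g \<cdot> ar L f = \<one> (ob L X)" "ar L f \<cdot> g = \<one> (ob L Y)"
    using is_isoE[OF Lf(2,1)] by blast
  note lX = localization_unit_hom[OF L obs(1)] and lY = localization_unit_hom[OF L obs(2)]
  have "(g \<cdot> l Y) \<cdot> f = l X"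
    using comp_assoc[OF f lY g(1)] localization_naturality[OF L f]
      cancel_left_inverse[OF Lf(1) g(1,2) lX] by simp
  then show ?thesis
    using that comp_hom[OF lY g(1)]
      iso_comp[OF lY localization_unit_iso_if_local[OF L Y] g(1) is_isoI[OF g(1) Lf(1) g(3,2)]]
    by blast
qed

end

context closed_symmetric_monoidal_V_category
begin

lemma localization_unit_pullback_iso:
  assumes L: "ir_localization_functor V E r L l"
  shows "is_iso V (pullback E r (l (Unit E)) (ob L (Unit E)))"
proof -
  have loc: "localization_functor E L l"
    using L by (simp add: ir_localization_functor_def)
  show ?thesis
    using L localization_unit_local_equivalence[OF loc unit_ob]
      localization_local_objectI[OF loc unit_ob] unfolding ir_localization_functor_def by blast
qed

text \<open>The map whose invertibility is rigidity is pullback along the local equivalence \<open>l (Unit E)\<close>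
  into a local object.\<close>

lemma localized_unit_monoid_rigid:
  assumes L: "ir_localization_functor V E r L l" and R: "localized_unit_monoid E L l R"
  shows "ir_rigid V E r R"
  using localization_unit_pullback_iso[OF L] R
  unfolding localized_unit_monoid_iff ir_rigid_def by simp

lemma orthogonal_localization_unit:
  assumes L: "ir_localization_functor V E r L l" and A: "A \<in> Ob V"
    and W: "isomorphic E W (ob i A)"
  shows "orthogonal E (\<one>\<^bsub>E\<^esub> W \<boxtimes>\<^bsub>E\<^esub> l (Unit E)) (ob L (Unit E))"
proof -
  have loc: "localization_functor E L l"
    using L by (simp add: ir_localization_functor_def)
  note unit = localization_unit_hom[OF loc unit_ob]
  have "orthogonal E (\<one>\<^bsub>E\<^esub> (ob i A) \<boxtimes>\<^bsub>E\<^esub> l (Unit E)) (ob L (Unit E))"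
    using orthogonal_if_pullback_iso[OF A unit] homD[OF unit]
      localization_unit_pullback_iso[OF L] by blast
  then show ?thesis
    using orthogonal_whisker_transfer[OF _ unit] W unfolding isomorphic_def by blast
qed

lemma isomorphic_image_tensor:
  assumes B: "B \<in> Ob V" and X: "isomorphic E X (ob i B)"
  shows "isomorphic E (X \<otimes>\<^bsub>E\<^esub> X) (ob i (B \<otimes>\<^bsub>V\<^esub> B))"
proof -
  obtain f where f: "f \<in> hom E X (ob i B)" "is_iso E f"
    using X unfolding isomorphic_def by blast
  show ?thesis
    using comp_hom[OF tens_hom[OF f(1) f(1)] m_hom[OF B B]]
      iso_comp[OF tens_hom[OF f(1) f(1)] tens_iso[OF f f] m_hom[OF B B] m_iso[OF B B]]
    unfolding isomorphic_def by blast
qed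

lemma unique_localized_unit_monoid:
  assumes L: "ir_localization_functor V E r L l"
    and B: "B \<in> Ob V" and LI: "isomorphic E (ob L (Unit E)) (ob i B)"
  shows "\<exists>!R. localized_unit_monoid E L l R"
proof -
  have loc: "localization_functor E L l"
    using L by (simp add: ir_localization_functor_def)
  have "isomorphic E (Unit E) (ob i (Unit V))"
    using m0_hom m0_iso unfolding isomorphic_def by blast
  then show ?thesis
    unfolding localized_unit_monoid_iff
    using unique_monoid_if_orthogonal[OF localization_unit_hom[OF loc unit_ob]]
      orthogonal_localization_unit[OF L base.unit_ob]
      orthogonal_localization_unit[OF L B LI]
      orthogonal_localization_unit[OF L base.tens_ob[OF B B] isomorphic_image_tensor[OF B LI]]
    by blast
qed

text \<open>Localizing at \<open>Eta R\<close> makes \<open>Eta R\<close> a local equivalence by definition, and rigidity is precisely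
  the condition for \<open>Carrier R\<close> to be local.\<close>

lemma rigid_is_localized_unit:
  assumes R: "ir_rigid V E r R" and L: "ir_class_localization_functor V E r {Eta R} L l"
  shows "\<exists>S. localized_unit_monoid E L l S \<and> monoid_isomorphic E R S"
proof -
  have monoid: "is_monoid E R" and iso: "is_iso V (pullback E r (Eta R) (Carrier R))"
    using R by (auto simp: ir_rigid_def)
  have loc: "localization_functor E L l"
    using L by (simp add: ir_class_localization_functor_def ir_localization_functor_def)
  note eta = monoidD(3)[OF monoid]
  have "Eta R \<in> local_equivalences E L"
    using L homD[OF eta]
    by (auto simp: ir_class_localization_functor_def class_local_equivalences_def
        class_local_objects_def)
  moreover have "Carrier R \<in> local_objects E L"
    using L iso homD[OF eta]
    by (auto simp: ir_class_localization_functor_def class_local_objects_def)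
  ultimately obtain \<phi> where phi: "\<phi> \<in> hom E (Carrier R) (ob L (Unit E))" "is_iso E \<phi>"
      "\<phi> \<cdot>\<^bsub>E\<^esub> Eta R = l (Unit E)"
    using local_equivalence_to_local_object[OF loc eta] by blast
  obtain S where "is_monoid E S" "Carrier S = ob L (Unit E)" "Eta S = l (Unit E)"
      "monoid_morphism E R S \<phi>"
    using monoid_transport[OF monoid phi(1,2)] phi(3) by metis
  then show ?thesis
    unfolding localized_unit_monoid_iff monoid_isomorphic_def using phi(2) by blast
qed

end

theorem theorem3p10:
  fixes V :: "('vo, 'vm) symmetric_monoidal_category"
    and E :: "('o, 'm) closed_symmetric_monoidal_category"
    and i :: "('vo, 'vm, 'o, 'm) cfunctor"
    and r :: "('o, 'm, 'vo, 'vm) cfunctor"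
    and u :: "'vo \<Rightarrow> 'vm" and c :: "'o \<Rightarrow> 'm"
    and m :: "'vo \<Rightarrow> 'vo \<Rightarrow> 'm" and m0 :: 'm
  assumes V_category: "closed_symmetric_monoidal_V_category V E i r u c m m0"
    and cocomplete: "cocomplete TYPE('k) E"
    and localizations_exist:
      "\<forall>f \<in> Arr E. \<exists>L l. ir_class_localization_functor V E r {f} L l"
  shows "(\<forall>L l. ir_localization_functor V E r L l \<and>
            (\<exists>B \<in> Ob V. isomorphic E (ob L (Unit E)) (ob i B)) \<longrightarrow>
            (\<exists>!R. localized_unit_monoid E L l R) \<and>
            (\<forall>R. localized_unit_monoid E L l R \<longrightarrow> ir_rigid V E r R)) \<and>
         (\<forall>R. ir_rigid V E r R \<longrightarrow>
            (\<exists>L l. ir_localization_functor V E r L l \<and>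
               (\<exists>S. localized_unit_monoid E L l S \<and> monoid_isomorphic E R S)))"
proof -
  interpret closed_symmetric_monoidal_V_category V E i r u c m m0
    by (rule V_category)
  have "\<exists>L l. ir_localization_functor V E r L l \<and>
      (\<exists>S. localized_unit_monoid E L l S \<and> monoid_isomorphic E R S)"
    if R: "ir_rigid V E r R" for R
  proof -
    have "Eta R \<in> Arr E"
      using R homD(1) monoidD(3) unfolding ir_rigid_def by blast
    then obtain L l where L: "ir_class_localization_functor V E r {Eta R} L l"
      using localizations_exist by blast
    then show ?thesis
      using rigid_is_localized_unit[OF R L] unfolding ir_class_localization_functor_def by blast
  qed
  then show ?thesis
    using unique_localized_unit_monoid localized_unit_monoid_rigid by blast
qed

end
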